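(* Let $B$ be a unital separable $C^*$-algebra and let $A\subset B$ be a unital norm-closed subalgebra. Let $A_0\subset A$ be the subset of elements $x$ with $\|x\|=1$ for which the set $R^{\mathcal{Q}}_x$ is a singleton. Then $A_0$ contains a $G_\delta$ dense subset of the unit sphere of $A$.
   Context: A unital subalgebra of $B$ contains the unit and need not be self-adjoint. $\mathcal{S}(B)$ is the state space of $B$. For $x\in B$, $N^{\mathcal{Q}}_x=\{\phi\in\mathcal{S}(B):\phi(x^*x)=\|x\|^2\}$ and $R^{\mathcal{Q}}_x=\{\phi|_A:\phi\in N^{\mathcal{Q}}_x\}$. The unit sphere of $A$ is $\{x\in A:\|x\|=1\}$ with the norm topology. *)

theory Defs
  imports "HOL-Analysis.Analysis"
begin

text \<open>
  Unital complex C*-algebras.  The ring, the real scalar multiplication, the norm (with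
  \<open>norm 1 = 1\<close>) and the induced metric come from \<^class>\<open>real_normed_algebra_1\<close>;
  the complex scalar multiplication is required to extend the real one.
\<close>

class unital_cstar_algebra = real_normed_algebra_1 + complete_space +
  fixes scaleC :: "complex \<Rightarrow> 'a \<Rightarrow> 'a"  (infixr \<open>*\<^sub>C\<close> 75)
    and star :: "'a \<Rightarrow> 'a"  (\<open>(_\<^sup>\<star>)\<close> [1000] 999)
  assumes scaleC_of_real: "complex_of_real r *\<^sub>C x = r *\<^sub>R x"
    and scaleC_add_right: "c *\<^sub>C (x + y) = c *\<^sub>C x + c *\<^sub>C y"
    and scaleC_add_left: "(c + d) *\<^sub>C x = c *\<^sub>C x + d *\<^sub>C x"
    and scaleC_scaleC: "c *\<^sub>C (d *\<^sub>C x) = (c * d) *\<^sub>C x"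
    and mult_scaleC_left: "(c *\<^sub>C x) * y = c *\<^sub>C (x * y)"
    and mult_scaleC_right: "x * (c *\<^sub>C y) = c *\<^sub>C (x * y)"
    and norm_scaleC: "norm (c *\<^sub>C x) = cmod c * norm x"
    and star_star: "(x\<^sup>\<star>)\<^sup>\<star> = x"
    and star_add: "(x + y)\<^sup>\<star> = x\<^sup>\<star> + y\<^sup>\<star>"
    and star_scaleC: "(c *\<^sub>C x)\<^sup>\<star> = cnj c *\<^sub>C x\<^sup>\<star>"
    and star_mult: "(x * y)\<^sup>\<star> = y\<^sup>\<star> * x\<^sup>\<star>"
    and cstar_identity: "norm (x\<^sup>\<star> * x) = (norm x)\<^sup>2"

instantiation complex :: unital_cstar_algebra
begin

definition scaleC_complex :: "complex \<Rightarrow> complex \<Rightarrow> complex"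
  where "scaleC_complex c x = c * x"

definition star_complex :: "complex \<Rightarrow> complex"
  where "star_complex = cnj"

instance
  by intro_classes
    (auto simp: scaleC_complex_def star_complex_def algebra_simps scaleR_conv_of_real
      norm_mult power2_eq_square)

end

text \<open>Not required to be closed under \<open>star\<close>.\<close>

definition unital_subalgebra :: "'a::unital_cstar_algebra set \<Rightarrow> bool" where
  "unital_subalgebra A \<longleftrightarrow>
     1 \<in> A \<and>
     (\<forall>x\<in>A. \<forall>y\<in>A. x + y \<in> A) \<and>
     (\<forall>c. \<forall>x\<in>A. c *\<^sub>C x \<in> A) \<and>
     (\<forall>x\<in>A. \<forall>y\<in>A. x * y \<in> A)"

definition states :: "('a::unital_cstar_algebra \<Rightarrow> complex) set" where
  "states = {\<phi>.
     (\<forall>x y. \<phi> (x + y) = \<phi> x + \<phi> y) \<and>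
     (\<forall>c x. \<phi> (c *\<^sub>C x) = c * \<phi> x) \<and>
     (\<forall>x. \<phi> (x\<^sup>\<star> * x) \<in> \<real>\<^sub>\<ge>\<^sub>0) \<and>
     \<phi> 1 = 1}"

definition norming_states :: "'a::unital_cstar_algebra \<Rightarrow> ('a \<Rightarrow> complex) set" where
  "norming_states x = {\<phi> \<in> states. \<phi> (x\<^sup>\<star> * x) = complex_of_real ((norm x)\<^sup>2)}"

definition restricted_norming_states ::
    "'a::unital_cstar_algebra set \<Rightarrow> 'a \<Rightarrow> ('a \<Rightarrow> complex) set" where
  "restricted_norming_states A x = (\<lambda>\<phi>. restrict \<phi> A) ` norming_states x"

definition unit_sphere :: "'a::unital_cstar_algebra set \<Rightarrow> 'a set" where
  "unit_sphere A = {x \<in> A. norm x = 1}"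

end

theory Submission
  imports Defs
begin

text \<open>
  The set \<open>A\<^sub>0\<close> contains every point of the unit sphere at which the norm of \<open>A\<close> is smooth, and by a
  theorem of Mazur the smooth points of a separable Banach space form a dense \<open>G\<^sub>\<delta>\<close> subset of its
  unit sphere.

  If \<open>\<phi>\<close> is a norming state of a unit vector \<open>x\<close>, then \<open>y \<mapsto> \<phi> (x\<^sup>\<star> * y)\<close> has norm at most 1 by
  the Cauchy-Schwarz inequality and takes the value 1 at \<open>x\<close>: it is a support functional of the unit
  ball at \<open>x\<close>. At a smooth point all these functionals agree on \<open>A\<close>. The restriction of \<open>\<phi>\<close> to
  \<open>A\<close> can be read off from its support functional: \<open>\<phi> ((1 - x\<^sup>\<star> * x)\<^sup>2) = 0\<close>, so Cauchy-Schwarz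
  gives \<open>\<phi> a = \<phi> (x\<^sup>\<star> * (x * a))\<close> (\<open>norming_state_star_mult_mult\<close>), and \<open>x * a\<close> lies in \<open>A\<close>
  because \<open>A\<close> is an algebra. Hence two norming states of a smooth point agree on \<open>A\<close>
  (\<open>smooth_norming_states_agree\<close>).

  Norming states exist (\<open>norming_states_nonempty\<close>) by the Hahn-Banach theorem, applied to the norm at
  the point \<open>1 + x\<^sup>\<star> * x\<close>, whose norm is \<open>1 + (norm x)\<^sup>2\<close>: a functional dominated by the norm and
  attaining it there must take the values 1 at \<open>1\<close> and \<open>(norm x)\<^sup>2\<close> at \<open>x\<^sup>\<star> * x\<close>. That it is
  nonnegative on all elements \<open>z\<^sup>\<star> * z\<close> rests on the one deep fact about C*-algebras involved,
  namely that \<open>z\<^sup>\<star> * z\<close> is positive (\<open>positive_star_mult\<close>). Positivity of a self-adjoint \<open>a\<close> is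
  expressed by the norm, as \<open>norm (t *\<^sub>R 1 - a) \<le> t\<close> for some \<open>t\<close>, and is handled through square roots given by the binomial
  series; spectra do not appear.

  Mazur's theorem (\<open>mazur_smooth_points\<close>) follows from Baire's theorem once it is known that for each
  direction \<open>y\<close> the points where the symmetric second difference of the norm along \<open>y\<close> is smaller than
  \<open>\<epsilon>\<close> times the step are dense. Along a line the norm is Lipschitz, and the second differences over
  an arithmetic progression telescope, so they cannot all be large.
\<close>

section \<open>Calculus with the involution\<close>

instance unital_cstar_algebra \<subseteq> banach ..

lemma star_scaleR: "(r *\<^sub>R x)\<^sup>\<star> = r *\<^sub>R (x::'a::unital_cstar_algebra)\<^sup>\<star>"
  by (metis scaleC_of_real star_scaleC complex_cnj_complex_of_real)

lemma star_one [simp]: "(1::'a::unital_cstar_algebra)\<^sup>\<star> = 1"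
  by (metis star_mult star_star mult_1_right)

lemma star_minus: "(- x)\<^sup>\<star> = - (x::'a::unital_cstar_algebra)\<^sup>\<star>"
  using star_scaleR[of "-1" x] by simp

lemma star_diff: "(x - y)\<^sup>\<star> = x\<^sup>\<star> - (y::'a::unital_cstar_algebra)\<^sup>\<star>"
  using star_add[of x "- y"] by (simp add: star_minus)

lemma star_zero [simp]: "(0::'a::unital_cstar_algebra)\<^sup>\<star> = 0"
  using star_diff[of 0 "0::'a"] by simp

lemma star_power: "(x ^ n)\<^sup>\<star> = (x::'a::unital_cstar_algebra)\<^sup>\<star> ^ n"
  by (induction n) (simp_all add: star_mult power_commutes)

lemma norm_star [simp]: "norm (x\<^sup>\<star>) = norm (x::'a::unital_cstar_algebra)"
proof -
  have *: "norm z \<le> norm (z\<^sup>\<star>)" for z :: 'a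
  proof (cases "norm z = 0")
    case False
    have "norm z * norm z \<le> norm (z\<^sup>\<star>) * norm z"
      by (metis cstar_identity norm_mult_ineq power2_eq_square)
    with False show ?thesis by simp
  qed simp
  show ?thesis
    using *[of x] *[of "x\<^sup>\<star>"] by (simp add: star_star)
qed

lemma bounded_linear_star: "bounded_linear (star :: 'a::unital_cstar_algebra \<Rightarrow> 'a)"
  by (rule bounded_linear_intro[where K = 1]) (simp_all add: star_add star_scaleR)

lemma scaleC_one [simp]: "1 *\<^sub>C x = (x::'a::unital_cstar_algebra)"
  using scaleC_of_real[of 1 x] by simp

lemma scaleC_minus_one: "(- 1) *\<^sub>C x = - (x::'a::unital_cstar_algebra)"
  using scaleC_of_real[of "-1" x] by simp

lemma scaleC_minus_left: "(- c) *\<^sub>C x = - (c *\<^sub>C (x::'a::unital_cstar_algebra))"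
  using scaleC_scaleC[of "-1" c x] by (simp add: scaleC_minus_one)

lemma scaleC_minus_right: "c *\<^sub>C (- x) = - (c *\<^sub>C (x::'a::unital_cstar_algebra))"
  using scaleC_scaleC[of c "-1" x] by (simp add: scaleC_minus_one scaleC_minus_left)

lemma scaleC_diff_right: "c *\<^sub>C (x - y) = c *\<^sub>C x - c *\<^sub>C (y::'a::unital_cstar_algebra)"
  using scaleC_add_right[of c x "- y"] by (simp add: scaleC_minus_right)

lemma norm_selfadjoint_sq:
  fixes u :: "'a::unital_cstar_algebra"
  assumes "u\<^sup>\<star> = u"
  shows "norm (u * u) = (norm u)\<^sup>2"
  using cstar_identity[of u] assms by simp

section \<open>Square roots from the binomial series\<close>

text \<open>
  The Taylor coefficients of \<open>sqrt (1 - z)\<close>. All but the first are negative and their sum over all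
  indices is 0, which is why the series converges absolutely on the closed unit disc.
\<close>

definition sqrt_coeff :: "nat \<Rightarrow> real" where
  "sqrt_coeff n = (- 1) ^ n * ((1/2) gchoose n)"

lemma sqrt_coeff_0 [simp]: "sqrt_coeff 0 = 1"
  by (simp add: sqrt_coeff_def)

lemma sqrt_coeff_Suc: "real (Suc n) * sqrt_coeff (Suc n) = (real n - 1/2) * sqrt_coeff n"
proof -
  have "(1/2::real) * ((1/2) gchoose n) = real n * ((1/2) gchoose n) + real (Suc n) * ((1/2) gchoose Suc n)"
    by (rule gbinomial_mult_1)
  then have "real (Suc n) * ((1/2) gchoose Suc n) = (1/2 - real n) * ((1/2) gchoose n)"
    by (simp add: algebra_simps)
  then have "- ((- 1) ^ n) * (real (Suc n) * ((1/2) gchoose Suc n)) = - ((- 1) ^ n) * ((1/2 - real n) * ((1/2) gchoose n))"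
    by simp
  then show ?thesis
    unfolding sqrt_coeff_def by (simp add: algebra_simps)
qed

lemma sqrt_coeff_Suc_neg: "sqrt_coeff (Suc n) < 0"
proof (induction n)
  case 0
  then show ?case using sqrt_coeff_Suc[of 0] by simp
next
  case (Suc n)
  have "(real (Suc n) - 1/2) * sqrt_coeff (Suc n) < 0"
    using Suc by (intro mult_pos_neg) auto
  then have "real (Suc (Suc n)) * sqrt_coeff (Suc (Suc n)) < 0"
    using sqrt_coeff_Suc[of "Suc n"] by simp
  then show ?case by (simp add: mult_less_0_iff)
qed

text \<open>
  The closed form makes the partial sums visibly nonnegative; since only the coefficient 1 of index 0 is
  positive, the absolute values of the others sum to at most 1.
\<close>

lemma sum_sqrt_coeff: "(\<Sum>k\<le>n. sqrt_coeff k) = (1 - 2 * real n) * sqrt_coeff n"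
proof (induction n)
  case (Suc n)
  have "(1 - 2 * real n) * sqrt_coeff n = - 2 * (real (Suc n) * sqrt_coeff (Suc n))"
    unfolding sqrt_coeff_Suc by (simp add: algebra_simps)
  with Suc show ?case by (simp add: algebra_simps)
qed simp

lemma sum_abs_sqrt_coeff_le: "(\<Sum>k<n. \<bar>sqrt_coeff (Suc k)\<bar>) \<le> 1"
proof -
  have "0 \<le> (\<Sum>k\<le>n. sqrt_coeff k)"
  proof (cases n)
    case (Suc m)
    then show ?thesis
      unfolding sum_sqrt_coeff using sqrt_coeff_Suc_neg[of m]
      by (intro mult_nonpos_nonpos) auto
  qed simp
  also have "(\<Sum>k\<le>n. sqrt_coeff k) = 1 + (\<Sum>k<n. sqrt_coeff (Suc k))"
    by (subst lessThan_Suc_atMost[symmetric], subst sum.lessThan_Suc_shift) simp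
  also have "(\<Sum>k<n. sqrt_coeff (Suc k)) = - (\<Sum>k<n. \<bar>sqrt_coeff (Suc k)\<bar>)"
    unfolding sum_negf[symmetric]
    by (intro sum.cong refl) (use sqrt_coeff_Suc_neg in \<open>auto simp: less_imp_le\<close>)
  finally show ?thesis by simp
qed

lemma summable_abs_sqrt_coeff_Suc: "summable (\<lambda>k. \<bar>sqrt_coeff (Suc k)\<bar>)"
  by (rule summableI_nonneg_bounded[where x = 1]) (use sum_abs_sqrt_coeff_le in auto)

lemma summable_abs_sqrt_coeff: "summable (\<lambda>k. \<bar>sqrt_coeff k\<bar>)"
  using summable_abs_sqrt_coeff_Suc by (subst (asm) summable_Suc_iff)

lemma suminf_abs_sqrt_coeff_le: "(\<Sum>k. \<bar>sqrt_coeff (Suc k)\<bar>) \<le> 1"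
  by (rule suminf_le_const[OF summable_abs_sqrt_coeff_Suc sum_abs_sqrt_coeff_le])

lemma sqrt_coeff_convolution:
  "(\<Sum>i\<le>n. sqrt_coeff i * sqrt_coeff (n - i)) = (if n = 0 then 1 else if n = 1 then - 1 else 0)"
proof -
  have "(\<Sum>i\<le>n. sqrt_coeff i * sqrt_coeff (n - i)) =
      (\<Sum>i\<le>n. (- 1) ^ n * (((1/2) gchoose i) * ((1/2) gchoose (n - i))))"
  proof (intro sum.cong refl)
    fix i assume "i \<in> {..n}"
    then have "(- 1) ^ n = (- 1::real) ^ i * (- 1) ^ (n - i)"
      by (simp flip: power_add)
    then show "sqrt_coeff i * sqrt_coeff (n - i) = (- 1) ^ n * (((1/2) gchoose i) * ((1/2) gchoose (n - i)))"
      by (simp add: sqrt_coeff_def)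
  qed
  also have "\<dots> = (- 1) ^ n * (1 gchoose n)"
    using gbinomial_Vandermonde[of "1/2::real" "1/2" n]
    by (simp add: sum_distrib_left[symmetric] atMost_atLeast0)
  also have "(1 gchoose n) = real (1 choose n)"
    by (metis binomial_gbinomial of_nat_1)
  also have "(- 1) ^ n * real (1 choose n) = (if n = 0 then 1 else if n = 1 then - 1 else 0)"
    by (auto simp: binomial_eq_0)
  finally show ?thesis .
qed

text \<open>
  The binomial series converges even for \<open>norm h = 1\<close>, so the root is exact on the boundary, without
  an approximation. The root is a limit of real polynomials in \<open>h\<close>; hence it inherits
  self-adjointness and commutes with whatever commutes with \<open>h\<close>. For self-adjoint \<open>h\<close>, the bound on
  \<open>norm (1 - u)\<close> makes \<open>u\<close> itself positive in the sense defined below.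
\<close>

lemma sqrt_one_minus:
  fixes h :: "'a::unital_cstar_algebra"
  assumes h: "norm h \<le> 1"
  obtains u where "u * u = 1 - h" "norm (1 - u) \<le> 1" "h\<^sup>\<star> = h \<Longrightarrow> u\<^sup>\<star> = u"
    "\<And>z. z * h = h * z \<Longrightarrow> z * u = u * z"
proof -
  define f where "f k = sqrt_coeff k *\<^sub>R h ^ k" for k
  have nf: "norm (f k) \<le> \<bar>sqrt_coeff k\<bar>" for k
  proof -
    have "norm (h ^ k) \<le> 1"
      using norm_power_ineq[of h k] power_le_one[of "norm h" k] h by simp
    then show ?thesis unfolding f_def by (simp add: mult_left_le)
  qed
  have sumn: "summable (\<lambda>k. norm (f k))"
    using summable_abs_sqrt_coeff by (rule summable_comparison_test') (use nf in auto)
  have sum: "summable f" by (rule summable_norm_cancel[OF sumn])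
  define u where "u = (\<Sum>k. f k)"
  have "(\<lambda>k. \<Sum>i\<le>k. f i * f (k - i)) sums (u * u)"
    unfolding u_def by (rule Cauchy_product_sums[OF sumn sumn])
  moreover have "(\<Sum>i\<le>k. f i * f (k - i)) = (if k = 0 then 1 else if k = 1 then - h else 0)" for k
  proof -
    have "(\<Sum>i\<le>k. f i * f (k - i)) = (\<Sum>i\<le>k. (sqrt_coeff i * sqrt_coeff (k - i)) *\<^sub>R h ^ k)"
      by (intro sum.cong refl) (simp add: f_def flip: power_add)
    also have "\<dots> = (if k = 0 then 1 else if k = 1 then - 1 else 0) *\<^sub>R h ^ k"
      unfolding scaleR_sum_left[symmetric] sqrt_coeff_convolution ..
    finally show ?thesis by auto
  qed
  ultimately have "(\<lambda>k. if k = 0 then 1 else if k = 1 then - h else 0) sums (u * u)"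
    by simp
  moreover have "(\<lambda>k. if k = 0 then 1 else if k = 1 then - h else 0) sums
      (\<Sum>k\<in>{0, 1::nat}. if k = 0 then 1 else if k = 1 then - h else 0)"
    by (rule sums_finite) auto
  ultimately have "u * u = 1 - h"
    using sums_unique2 by fastforce
  moreover have "norm (1 - u) \<le> 1"
  proof -
    have nS: "summable (\<lambda>k. norm (f (Suc k)))" using sumn by (subst summable_Suc_iff)
    have "u = f 0 + (\<Sum>k. f (Suc k))"
      unfolding u_def using suminf_split_head[OF sum] by simp
    then have "norm (1 - u) = norm (\<Sum>k. f (Suc k))"
      by (simp add: f_def)
    also have "\<dots> \<le> (\<Sum>k. norm (f (Suc k)))"
      by (rule summable_norm[OF nS])
    also have "\<dots> \<le> (\<Sum>k. \<bar>sqrt_coeff (Suc k)\<bar>)"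
      by (rule suminf_le[OF nf nS summable_abs_sqrt_coeff_Suc])
    also have "\<dots> \<le> 1" by (rule suminf_abs_sqrt_coeff_le)
    finally show ?thesis .
  qed
  moreover have "u\<^sup>\<star> = u" if "h\<^sup>\<star> = h"
    unfolding u_def bounded_linear.suminf[OF bounded_linear_star sum]
    using that by (simp add: f_def[abs_def] star_scaleR star_power)
  moreover have "z * u = u * z" if "z * h = h * z" for z
  proof -
    have "z * f k = f k * z" for k
      using power_commuting_commutes[of h z k] that unfolding f_def by simp
    then show ?thesis
      unfolding u_def suminf_mult[OF sum, symmetric] suminf_mult2[OF sum] by simp
  qed
  ultimately show ?thesis using that by blast
qed

section \<open>The positive cone\<close>

text \<open>
  For self-adjoint \<open>a\<close> the norm condition expresses that the spectrum of \<open>a\<close> lies in \<open>[0, 2 * t]\<close>. In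
  this form, that positive elements are a convex cone is the triangle inequality.
\<close>

definition positive :: "'a::unital_cstar_algebra \<Rightarrow> bool" where
  "positive a \<longleftrightarrow> a\<^sup>\<star> = a \<and> (\<exists>t. norm (t *\<^sub>R 1 - a) \<le> t)"

lemma positive_add:
  fixes a b :: "'a::unital_cstar_algebra"
  assumes "positive a" "positive b"
  shows "positive (a + b)"
proof -
  obtain s t where st: "norm (s *\<^sub>R 1 - a) \<le> s" "norm (t *\<^sub>R 1 - b) \<le> t"
    using assms unfolding positive_def by blast
  have "norm ((s + t) *\<^sub>R 1 - (a + b)) = norm ((s *\<^sub>R 1 - a) + (t *\<^sub>R 1 - b))"
    by (simp add: algebra_simps)
  also have "\<dots> \<le> s + t"
    using st norm_triangle_mono by blast
  finally show ?thesis
    using assms unfolding positive_def by (auto simp: star_add)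
qed

lemma positive_scaleR:
  fixes a :: "'a::unital_cstar_algebra"
  assumes "positive a" "0 \<le> r"
  shows "positive (r *\<^sub>R a)"
proof -
  obtain t where t: "norm (t *\<^sub>R 1 - a) \<le> t"
    using assms unfolding positive_def by blast
  have "norm ((r * t) *\<^sub>R 1 - r *\<^sub>R a) = r * norm (t *\<^sub>R 1 - a)"
    using \<open>0 \<le> r\<close> by (simp flip: scaleR_scaleR scaleR_diff_right)
  also have "\<dots> \<le> r * t" using t assms(2) by (rule mult_left_mono)
  finally show ?thesis
    using assms unfolding positive_def by (auto simp: star_scaleR)
qed

lemma positive_sqrt:
  fixes a :: "'a::unital_cstar_algebra"
  assumes "positive a"
  obtains u where "positive u" "u * u = a" "\<And>z. z * a = a * z \<Longrightarrow> z * u = u * z"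
proof -
  obtain t where t: "norm (t *\<^sub>R 1 - a) \<le> t" and sa: "a\<^sup>\<star> = a"
    using assms unfolding positive_def by blast
  show ?thesis
  proof (cases "t = 0")
    case True
    then have "a = 0" using t by simp
    then show ?thesis
      using that[of 0] assms by simp
  next
    case False
    then have "0 < t" using t norm_ge_zero[of "t *\<^sub>R 1 - a"] by linarith
    define h where "h = 1 - (1 / t) *\<^sub>R a"
    have a: "a = t *\<^sub>R (1 - h)" using \<open>0 < t\<close> by (simp add: h_def)
    have "t * norm h = norm (t *\<^sub>R 1 - a)"
      using \<open>0 < t\<close> by (simp add: a algebra_simps)
    with t have "t * norm h \<le> t * 1" by simp
    then have "norm h \<le> 1" using \<open>0 < t\<close> by (simp only: mult_le_cancel_left_pos)
    then obtain v where v: "v * v = 1 - h" "norm (1 - v) \<le> 1" "h\<^sup>\<star> = h \<Longrightarrow> v\<^sup>\<star> = v"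
      "\<And>z. z * h = h * z \<Longrightarrow> z * v = v * z"
      using sqrt_one_minus by blast
    have "h\<^sup>\<star> = h" by (simp add: h_def star_diff star_scaleR sa)
    then have "positive v"
      unfolding positive_def using v(2) v(3) by (intro conjI exI[of _ 1]) auto
    show ?thesis
    proof (rule that[of "sqrt t *\<^sub>R v"])
      show "positive (sqrt t *\<^sub>R v)"
        using \<open>positive v\<close> \<open>0 < t\<close> by (intro positive_scaleR) auto
      show "sqrt t *\<^sub>R v * sqrt t *\<^sub>R v = a"
        using \<open>0 < t\<close> by (simp add: a v(1))
      show "z * sqrt t *\<^sub>R v = sqrt t *\<^sub>R v * z" if "z * a = a * z" for z
        using v(4)[of z] that by (simp add: h_def algebra_simps)
    qed
  qed
qed

text \<open>
  Adding a commuting square does not decrease the norm: \<open>u + \<i> v\<close> and its adjoint \<open>u - \<i> v\<close> have as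
  square of their norm the norm of \<open>u * u + v * v\<close>, and \<open>u\<close> is their mean. This inequality takes the
  place of spectral calculus in comparing norms of positive elements.
\<close>

lemma norm_sq_le_sum_squares:
  fixes u v :: "'a::unital_cstar_algebra"
  assumes u: "u\<^sup>\<star> = u" and v: "v\<^sup>\<star> = v" and c: "u * v = v * u"
  shows "(norm u)\<^sup>2 \<le> norm (u * u + v * v)"
proof -
  define p where "p = u + \<i> *\<^sub>C v"
  define q where "q = u - \<i> *\<^sub>C v"
  have sp: "p\<^sup>\<star> = q" and sq: "q\<^sup>\<star> = p"
    by (simp_all add: p_def q_def star_add star_diff star_scaleC u v scaleC_minus_left)
  have qp: "q * p = u * u + v * v"
    by (simp add: p_def q_def algebra_simps mult_scaleC_left mult_scaleC_right scaleC_scaleC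
        scaleC_diff_right scaleC_add_right
        scaleC_minus_one c)
  have pq: "norm q = norm p"
    using sp norm_star[of p] by simp
  have "(norm p)\<^sup>2 = norm (u * u + v * v)"
    using cstar_identity[of p] by (simp add: sp qp)
  moreover have "2 *\<^sub>R u = p + q"
    by (simp add: p_def q_def scaleR_2)
  then have "2 * norm u \<le> norm p + norm q"
    by (metis norm_scaleR norm_triangle_ineq abs_numeral)
  then have "norm u \<le> norm p" using pq by simp
  ultimately show ?thesis
    by (metis norm_ge_zero power_mono)
qed

lemma norm_sq_minus_square:
  fixes u :: "'a::unital_cstar_algebra"
  assumes u: "u\<^sup>\<star> = u"
  obtains w where "w\<^sup>\<star> = w" "u * u + w * w = (norm u)\<^sup>2 *\<^sub>R 1"
    "\<And>z. z * u = u * z \<Longrightarrow> z * w = w * z"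
proof (cases "u = 0")
  case True
  then show ?thesis using that[of 0] by simp
next
  case False
  define r where "r = norm u"
  have "r > 0" using False by (simp add: r_def)
  define h where "h = (1 / r\<^sup>2) *\<^sub>R (u * u)"
  have hs: "h\<^sup>\<star> = h" by (simp add: h_def star_scaleR star_mult u)
  have "norm h \<le> 1"
    using norm_selfadjoint_sq[OF u] \<open>r > 0\<close> by (simp add: h_def r_def)
  then obtain v where v: "v * v = 1 - h" "v\<^sup>\<star> = v" "\<And>z. z * h = h * z \<Longrightarrow> z * v = v * z"
    using sqrt_one_minus hs by metis
  show ?thesis
  proof (rule that[of "r *\<^sub>R v"])
    show "(r *\<^sub>R v)\<^sup>\<star> = r *\<^sub>R v" by (simp add: star_scaleR v(2))
    show "u * u + r *\<^sub>R v * r *\<^sub>R v = (norm u)\<^sup>2 *\<^sub>R 1"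
      using \<open>r > 0\<close> by (simp add: v(1) h_def r_def[symmetric] power2_eq_square algebra_simps)
    show "z * r *\<^sub>R v = r *\<^sub>R v * z" if "z * u = u * z" for z
    proof -
      have "z * (u * u) = u * u * z" by (metis that mult.assoc)
      then show ?thesis using v(3)[of z] by (simp add: h_def)
    qed
  qed
qed

text \<open>
  Complement \<open>u * u\<close> by a commuting square to a multiple of the unit: the complement cannot have a larger
  norm than that multiple, which is the estimate required for positivity.
\<close>

lemma positive_square:
  fixes u :: "'a::unital_cstar_algebra"
  assumes u: "u\<^sup>\<star> = u"
  shows "positive (u * u)"
proof -
  obtain w where w: "w\<^sup>\<star> = w" "u * u + w * w = (norm u)\<^sup>2 *\<^sub>R 1" "u * w = w * u"
    using norm_sq_minus_square[OF u] by blast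
  have "(norm w)\<^sup>2 \<le> norm (w * w + u * u)"
    by (rule norm_sq_le_sum_squares) (use w u in auto)
  also have "w * w + u * u = (norm u)\<^sup>2 *\<^sub>R 1"
    using w(2) by (simp add: add.commute)
  finally have "(norm w)\<^sup>2 \<le> (norm u)\<^sup>2" by simp
  moreover have "(norm u)\<^sup>2 *\<^sub>R 1 - u * u = w * w"
    by (simp flip: w(2))
  ultimately have "norm ((norm u)\<^sup>2 *\<^sub>R 1 - u * u) \<le> (norm u)\<^sup>2"
    using norm_selfadjoint_sq[OF w(1)] by simp
  then show ?thesis
    unfolding positive_def by (auto simp: star_mult u)
qed

lemma positive_antisym:
  fixes a :: "'a::unital_cstar_algebra"
  assumes "positive a" "positive (- a)"
  shows "a = 0"
proof -
  obtain u where u: "positive u" "u * u = a" "\<And>z. z * a = a * z \<Longrightarrow> z * u = u * z"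
    using positive_sqrt[OF assms(1)] by blast
  obtain v where v: "positive v" "v * v = - a" "\<And>z. z * (- a) = - a * z \<Longrightarrow> z * v = v * z"
    using positive_sqrt[OF assms(2)] by blast
  have "u * a = a * u" by (simp flip: u(2) add: mult.assoc)
  then have "u * v = v * u" using v(3)[of u] by simp
  then have "(norm u)\<^sup>2 \<le> norm (u * u + v * v)"
    using u(1) v(1) unfolding positive_def by (intro norm_sq_le_sum_squares) auto
  then have "u = 0" by (simp add: u(2) v(2))
  then show ?thesis using u(2) by simp
qed

text \<open>
  With \<open>s = norm (1 + a)\<close>, the element \<open>s *\<^sub>R 1 - (1 + a)\<close> is a square \<open>w * w\<close>. So \<open>a\<close> and \<open>w * w\<close>
  are commuting squares with sum \<open>(s - 1) *\<^sub>R 1\<close>, and neither exceeds \<open>s - 1\<close> in norm.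
\<close>

lemma norm_one_plus_positive:
  fixes a :: "'a::unital_cstar_algebra"
  assumes "positive a"
  shows "norm (1 + a) = 1 + norm a"
proof (rule antisym)
  show "norm (1 + a) \<le> 1 + norm a"
    using norm_triangle_ineq[of 1 a] by simp
  obtain v where v: "positive v" "v * v = a" "\<And>z. z * a = a * z \<Longrightarrow> z * v = v * z"
    using positive_sqrt[OF assms] by blast
  have vs: "v\<^sup>\<star> = v" and as: "a\<^sup>\<star> = a" using v(1) assms by (auto simp: positive_def)
  have "positive (1 + a)"
    using positive_add[OF positive_square[of 1] assms] by simp
  then obtain u where u: "positive u" "u * u = 1 + a" "\<And>z. z * (1 + a) = (1 + a) * z \<Longrightarrow> z * u = u * z"
    using positive_sqrt by blast
  have us: "u\<^sup>\<star> = u" using u(1) by (simp add: positive_def)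
  have "v * a = a * v" by (simp flip: v(2) add: mult.assoc)
  then have vu: "v * u = u * v" using u(3)[of v] by (simp add: algebra_simps)
  obtain w where w: "w\<^sup>\<star> = w" "u * u + w * w = (norm u)\<^sup>2 *\<^sub>R 1" "\<And>z. z * u = u * z \<Longrightarrow> z * w = w * z"
    using norm_sq_minus_square[OF us] by blast
  define s where "s = norm (1 + a)"
  have "(norm u)\<^sup>2 = s" using norm_selfadjoint_sq[OF us] by (simp add: u(2) s_def)
  then have vw: "v * v + w * w = (s - 1) *\<^sub>R 1"
    using w(2) by (simp add: u(2) v(2) algebra_simps)
  have "(norm (1::'a))\<^sup>2 \<le> norm (1 * 1 + v * v)"
    by (rule norm_sq_le_sum_squares) (use vs in auto)
  then have "1 \<le> s" by (simp add: s_def v(2))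
  have "norm a = (norm v)\<^sup>2" using norm_selfadjoint_sq[OF vs] by (simp add: v(2))
  also have "\<dots> \<le> norm (v * v + w * w)"
    by (rule norm_sq_le_sum_squares) (use vs w(1) w(3)[OF vu] in auto)
  also have "\<dots> = s - 1" using \<open>1 \<le> s\<close> by (simp add: vw)
  finally show "1 + norm a \<le> norm (1 + a)" by (simp add: s_def)
qed

lemma norm_selfadjoint_power:
  fixes k :: "'a::unital_cstar_algebra"
  assumes "k\<^sup>\<star> = k"
  shows "norm (k ^ (2 ^ n)) = norm k ^ (2 ^ n)"
proof (induction n)
  case (Suc n)
  have "(k ^ (2 ^ n))\<^sup>\<star> = k ^ (2 ^ n)" by (simp add: star_power assms)
  then show ?case
    using norm_selfadjoint_sq[of "k ^ (2 ^ n)"] Suc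
    by (simp add: power_mult power_even_eq power2_eq_square flip: power_add mult_2)
qed simp

text \<open>
  Taking roots of order \<open>2 ^ n\<close> kills the polynomial factor \<open>2 ^ n\<close>. Only exponents that are powers of two
  occur, because the C*-identity computes the norm of a self-adjoint power for those.
\<close>

lemma norm_le_if_power_growth:
  fixes x t C :: real
  assumes x: "0 \<le> x" and t: "0 \<le> t" and bd: "\<And>n. x ^ (2 ^ n) \<le> t ^ (2 ^ n) + real (2 ^ n) * t ^ (2 ^ n - 1) * C"
  shows "x \<le> t"
proof (rule ccontr)
  assume "\<not> x \<le> t"
  then have "t < x" by simp
  show False
  proof (cases "t = 0")
    case True
    have "x ^ 2 \<le> 0" using bd[of 1] True by simp
    then show False using \<open>t < x\<close> True by simp
  next
    case False
    then have "t > 0" using t by simp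
    define q where "q = t / x"
    have q: "0 < q" "q < 1" using \<open>t < x\<close> \<open>t > 0\<close> by (auto simp: q_def)
    have "filterlim (\<lambda>n. 2 ^ n :: nat) sequentially sequentially"
      by (rule filterlim_subseq) (auto intro: strict_monoI power_strict_increasing)
    moreover have "(\<lambda>m. q ^ m + (real m * q ^ m) * (C / t)) \<longlonglongrightarrow> 0 + 0 * (C / t)"
      using q by (intro tendsto_intros powser_times_n_limit_0 LIMSEQ_realpow_zero) auto
    ultimately have "(\<lambda>n. q ^ (2 ^ n) + (real (2 ^ n) * q ^ (2 ^ n)) * (C / t)) \<longlonglongrightarrow> 0"
      using filterlim_compose by fastforce
    moreover have "1 \<le> q ^ (2 ^ n) + (real (2 ^ n) * q ^ (2 ^ n)) * (C / t)" for n
    proof -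
      have "t ^ (2 ^ n) = t * t ^ (2 ^ n - 1)"
        by (metis power_eq_if power_not_zero zero_neq_numeral)
      then have "t ^ (2 ^ n - 1) = t ^ (2 ^ n) / t" using \<open>t > 0\<close> by simp
      then have "x ^ (2 ^ n) \<le> t ^ (2 ^ n) + real (2 ^ n) * t ^ (2 ^ n) * (C / t)"
        using bd[of n] by simp
      then have "x ^ (2 ^ n) / x ^ (2 ^ n) \<le> (t ^ (2 ^ n) + real (2 ^ n) * t ^ (2 ^ n) * (C / t)) / x ^ (2 ^ n)"
        using \<open>t < x\<close> \<open>t > 0\<close> by (intro divide_right_mono) auto
      then show ?thesis
        using \<open>t < x\<close> \<open>t > 0\<close> by (simp add: q_def power_divide add_divide_distrib mult.commute)
    qed
    ultimately have "1 \<le> (0::real)"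
      by (meson LIMSEQ_le_const)
    then show False by simp
  qed
qed

text \<open>
  Instead of comparing the spectra of \<open>y\<^sup>\<star> * y\<close> and \<open>y * y\<^sup>\<star>\<close>, compare powers of the shifts
  \<open>b = t *\<^sub>R 1 + y\<^sup>\<star> * y\<close> and \<open>k = t *\<^sub>R 1 + y * y\<^sup>\<star>\<close>. Since \<open>k * y = y * b\<close>, powers of \<open>k\<close>
  reduce to powers of \<open>b\<close>, and \<open>norm b \<le> t\<close> bounds \<open>k ^ n\<close> by \<open>t ^ n\<close> up to a term that is
  larger only by a factor linear in \<open>n\<close>. For the self-adjoint \<open>k\<close> this forces \<open>norm k \<le> t\<close>.
\<close>

lemma positive_neg_star_mult_swap:
  fixes y :: "'a::unital_cstar_algebra"
  assumes "positive (- (y\<^sup>\<star> * y))"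
  shows "positive (- (y * y\<^sup>\<star>))"
proof -
  obtain t where t: "norm (t *\<^sub>R 1 + y\<^sup>\<star> * y) \<le> t"
    using assms unfolding positive_def by auto
  define b where "b = t *\<^sub>R 1 + y\<^sup>\<star> * y"
  define k where "k = t *\<^sub>R 1 + y * y\<^sup>\<star>"
  have t0: "0 \<le> t" using t norm_ge_zero order_trans by blast
  have ks: "k\<^sup>\<star> = k" by (simp add: k_def star_add star_scaleR star_mult star_star)
  have ky: "k * y = y * b" by (simp add: k_def b_def algebra_simps)
  have kny: "k ^ n * y = y * b ^ n" for n
    by (induction n) (simp_all add: mult.assoc ky power_Suc2 del: power_Suc, simp add: ky mult.assoc[symmetric])
  have nb: "norm (b ^ n) \<le> t ^ n" for n
    using norm_power_ineq[of b n] power_mono[of "norm b" t n] t by (simp add: b_def)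
  have kS: "norm (k ^ Suc n) \<le> t ^ Suc n + real (Suc n) * t ^ n * (norm y)\<^sup>2" for n
  proof (induction n)
    case 0
    have "norm k \<le> norm (t *\<^sub>R (1::'a)) + norm (y * y\<^sup>\<star>)"
      unfolding k_def by (rule norm_triangle_ineq)
    also have "norm (y * y\<^sup>\<star>) \<le> (norm y)\<^sup>2"
      using norm_mult_ineq[of y "y\<^sup>\<star>"] by (simp add: power2_eq_square)
    finally show ?case using t0 by simp
  next
    case (Suc n)
    have "k ^ Suc (Suc n) = k ^ Suc n * k"
      by (rule power_Suc2)
    also have "\<dots> = t *\<^sub>R k ^ Suc n + k ^ Suc n * y * y\<^sup>\<star>"
      by (subst (2) k_def) (simp add: algebra_simps)
    also have "\<dots> = t *\<^sub>R k ^ Suc n + y * b ^ Suc n * y\<^sup>\<star>"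
      by (simp only: kny)
    finally have "norm (k ^ Suc (Suc n)) \<le> norm (t *\<^sub>R k ^ Suc n) + norm (y * b ^ Suc n * y\<^sup>\<star>)"
      using norm_triangle_ineq by metis
    also have "norm (y * b ^ Suc n * y\<^sup>\<star>) \<le> norm (y * b ^ Suc n) * norm y"
      using norm_mult_ineq[of "y * b ^ Suc n" "y\<^sup>\<star>"] by simp
    also have "\<dots> \<le> norm y * norm (b ^ Suc n) * norm y"
      by (intro mult_right_mono norm_mult_ineq) simp
    also have "\<dots> \<le> norm y * t ^ Suc n * norm y"
      using nb[of "Suc n"] by (intro mult_right_mono mult_left_mono) auto
    also have "norm (t *\<^sub>R k ^ Suc n) \<le> t * (t ^ Suc n + real (Suc n) * t ^ n * (norm y)\<^sup>2)"
      using Suc t0 by (simp add: mult_left_mono del: power_Suc)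
    finally show ?case
      by (simp add: algebra_simps power2_eq_square)
  qed
  have "norm k \<le> t"
  proof (rule norm_le_if_power_growth[where C = "(norm y)\<^sup>2"])
    show "norm k ^ (2 ^ n) \<le> t ^ (2 ^ n) + real (2 ^ n) * t ^ (2 ^ n - 1) * (norm y)\<^sup>2" for n
      using kS[of "2 ^ n - 1"] norm_selfadjoint_power[OF ks, of n] by simp
  qed (use t0 in auto)
  then show ?thesis
    unfolding positive_def by (auto simp: star_minus star_mult star_star k_def)
qed

lemma cartesian_decomposition:
  fixes y :: "'a::unital_cstar_algebra"
  obtains u v where "u\<^sup>\<star> = u" "v\<^sup>\<star> = v" "y = u + \<i> *\<^sub>C v"
proof (rule that[of "(1/2) *\<^sub>R (y + y\<^sup>\<star>)" "(- \<i> / 2) *\<^sub>C (y - y\<^sup>\<star>)"])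
  show "((1/2) *\<^sub>R (y + y\<^sup>\<star>))\<^sup>\<star> = (1/2) *\<^sub>R (y + y\<^sup>\<star>)"
    by (simp add: star_scaleR star_add star_star add.commute)
  have "((- \<i> / 2) *\<^sub>C (y - y\<^sup>\<star>))\<^sup>\<star> = (\<i> / 2) *\<^sub>C (- (y - y\<^sup>\<star>))"
    by (simp add: star_scaleC star_diff star_star)
  also have "\<dots> = (- \<i> / 2) *\<^sub>C (y - y\<^sup>\<star>)"
    unfolding scaleC_minus_right by (simp add: scaleC_minus_left)
  finally show "((- \<i> / 2) *\<^sub>C (y - y\<^sup>\<star>))\<^sup>\<star> = (- \<i> / 2) *\<^sub>C (y - y\<^sup>\<star>)" .
  have "\<i> *\<^sub>C (- \<i> / 2) *\<^sub>C (y - y\<^sup>\<star>) = (1/2) *\<^sub>R (y - y\<^sup>\<star>)"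
    by (simp add: scaleC_scaleC flip: scaleC_of_real)
  then show "y = (1/2) *\<^sub>R (y + y\<^sup>\<star>) + \<i> *\<^sub>C (- \<i> / 2) *\<^sub>C (y - y\<^sup>\<star>)"
    by (simp add: algebra_simps flip: scaleR_add_left)
qed

text \<open>
  For \<open>y = u + \<i> v\<close> with self-adjoint \<open>u\<close> and \<open>v\<close> the mixed terms cancel and \<open>2 (u\<^sup>2 + v\<^sup>2)\<close>
  remains.
\<close>

lemma positive_star_mult_plus_mult_star:
  fixes y :: "'a::unital_cstar_algebra"
  shows "positive (y\<^sup>\<star> * y + y * y\<^sup>\<star>)"
proof -
  obtain u v where uv: "u\<^sup>\<star> = u" "v\<^sup>\<star> = v" and y: "y = u + \<i> *\<^sub>C v"
    using cartesian_decomposition by blast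
  have ys: "y\<^sup>\<star> = u - \<i> *\<^sub>C v"
    by (simp add: y star_add star_scaleC uv scaleC_minus_left)
  have "y\<^sup>\<star> * y + y * y\<^sup>\<star> = 2 *\<^sub>R (u * u + v * v)"
    unfolding ys unfolding y
    by (simp add: algebra_simps mult_scaleC_left mult_scaleC_right scaleC_scaleC
        scaleC_diff_right scaleC_add_right scaleC_minus_one scaleR_2)
  then show ?thesis
    using uv by (simp add: positive_scaleR positive_add positive_square)
qed

text \<open>
  Put \<open>a = x\<^sup>\<star> * x\<close>, let \<open>b\<close> be the absolute value of \<open>a\<close> (the root of \<open>a * a\<close>) and \<open>d = b - a\<close>,
  twice the negative part of \<open>a\<close>. For \<open>y = x * d\<close> the element \<open>y\<^sup>\<star> * y = d * a * d\<close> is the negative of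
  a square. The swap lemma gives the same sign to \<open>y * y\<^sup>\<star>\<close>, while the sum of the two is positive; so
  \<open>y\<^sup>\<star> * y\<close> is both positive and negative, hence 0. Then \<open>d = 0\<close>, that is, \<open>a = b\<close>.
\<close>

theorem positive_star_mult:
  fixes x :: "'a::unital_cstar_algebra"
  shows "positive (x\<^sup>\<star> * x)"
proof -
  define a where "a = x\<^sup>\<star> * x"
  have as: "a\<^sup>\<star> = a" by (simp add: a_def star_mult star_star)
  obtain b where b: "positive b" "b * b = a * a" "\<And>z. z * (a * a) = a * a * z \<Longrightarrow> z * b = b * z"
    using positive_sqrt[OF positive_square[OF as]] by blast
  have bs: "b\<^sup>\<star> = b" using b(1) by (simp add: positive_def)
  have ab: "a * b = b * a" by (rule b(3)) (simp add: mult.assoc)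
  obtain e where e: "positive e" "e * e = b" "\<And>z. z * b = b * z \<Longrightarrow> z * e = e * z"
    using positive_sqrt[OF b(1)] by blast
  have es: "e\<^sup>\<star> = e" using e(1) by (simp add: positive_def)
  define d where "d = b - a"
  have ds: "d\<^sup>\<star> = d" by (simp add: d_def star_diff as bs)
  have db: "d * b = b * d" by (simp add: d_def algebra_simps ab)
  have de: "d * e = e * d" by (rule e(3)[OF db])
  have da: "d * a = - (b * d)" by (simp add: d_def algebra_simps ab b(2))
  define y where "y = x * d"
  have "y\<^sup>\<star> * y = d * a * d" by (simp add: y_def star_mult ds a_def mult.assoc)
  also have "\<dots> = - (b * d * d)" by (simp add: da)
  also have "b * d * d = (e * d) * (e * d)"
    by (metis e(2) de mult.assoc)
  finally have yy: "y\<^sup>\<star> * y = - ((e * d) * (e * d))" .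
  have "(e * d)\<^sup>\<star> = e * d" by (simp add: star_mult es ds de)
  then have "positive (- (y\<^sup>\<star> * y))"
    by (simp add: yy positive_square)
  then have "positive (- (y * y\<^sup>\<star>))" by (rule positive_neg_star_mult_swap)
  with positive_star_mult_plus_mult_star[of y] have "positive (y\<^sup>\<star> * y)"
    using positive_add by fastforce
  with \<open>positive (- (y\<^sup>\<star> * y))\<close> have "y\<^sup>\<star> * y = 0" by (simp add: positive_antisym)
  then have bdd: "b * d * d = 0"
    using \<open>y\<^sup>\<star> * y = d * a * d\<close> da by simp
  \<comment> \<open>\<open>2 b = d + (b + a)\<close>, and \<open>b + a\<close> annihilates \<open>d\<close> because \<open>b\<^sup>2 = a\<^sup>2\<close>\<close>
  have "d * d * d = 2 *\<^sub>R (b * d * d) - (b + a) * d * d"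
    by (simp add: d_def algebra_simps scaleR_2)
  also have "(b + a) * d = 0"
    by (simp add: d_def algebra_simps ab b(2))
  finally have "d * d * d = 0" by (simp add: bdd)
  then have "d ^ (2 ^ 2) = 0" by (simp add: numeral_eq_Suc mult.assoc)
  then have "norm d ^ (2 ^ 2) = 0"
    using norm_selfadjoint_power[OF ds, of 2] by simp
  then have "a = b" by (simp add: d_def)
  then show ?thesis using b(1) by (simp add: a_def)
qed

section \<open>The Hahn-Banach theorem\<close>

definition sublinear :: "('a::real_vector \<Rightarrow> real) \<Rightarrow> bool" where
  "sublinear p \<longleftrightarrow> (\<forall>x y. p (x + y) \<le> p x + p y) \<and> (\<forall>r x. 0 \<le> r \<longrightarrow> p (r *\<^sub>R x) = r * p x)"

lemma sublinear_zero: "sublinear p \<Longrightarrow> p 0 = 0"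
  unfolding sublinear_def by (metis mult_zero_left order_refl scaleR_zero_left)

lemma sublinear_neg_le:
  assumes "sublinear p"
  shows "- p (- x) \<le> p x"
proof -
  have "p (x + (- x)) \<le> p x + p (- x)"
    using assms unfolding sublinear_def by blast
  then show ?thesis using sublinear_zero[OF assms] by simp
qed

lemma sublinearI:
  assumes add: "\<And>x y. p (x + y) \<le> p x + p y" and zero: "p 0 = 0"
    and scale: "\<And>r x. 0 < r \<Longrightarrow> p (r *\<^sub>R x) \<le> r * p x"
  shows "sublinear p"
proof -
  have "p (r *\<^sub>R x) = r * p x" if r: "0 < r" for r x
  proof (rule antisym[OF scale[OF r]])
    have "p ((1 / r) *\<^sub>R r *\<^sub>R x) \<le> (1 / r) * p (r *\<^sub>R x)"
      using r by (intro scale) simp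
    then show "r * p x \<le> p (r *\<^sub>R x)"
      using r by (simp add: field_simps)
  qed
  then show ?thesis
    unfolding sublinear_def using add zero by (auto simp: le_less)
qed

text \<open>
  The largest sublinear functional below \<open>p\<close> whose value at \<open>- z\<close> is at most \<open>- p z\<close>.
\<close>

definition lower_sublinear :: "('a::real_vector \<Rightarrow> real) \<Rightarrow> 'a \<Rightarrow> 'a \<Rightarrow> real" where
  "lower_sublinear p z x = (INF t\<in>{0..}. p (x + t *\<^sub>R z) - t * p z)"

lemma lower_sublinear_le:
  assumes p: "sublinear p" and t: "0 \<le> t"
  shows "lower_sublinear p z x \<le> p (x + t *\<^sub>R z) - t * p z"
  unfolding lower_sublinear_def
proof (rule cINF_lower)
  have "- p (- x) \<le> p (x + s *\<^sub>R z) - s * p z" if "0 \<le> s" for s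
  proof -
    have "s * p z = p ((x + s *\<^sub>R z) + (- x))"
      using p that unfolding sublinear_def by simp
    also have "\<dots> \<le> p (x + s *\<^sub>R z) + p (- x)"
      using p unfolding sublinear_def by blast
    finally show ?thesis by simp
  qed
  then show "bdd_below ((\<lambda>t. p (x + t *\<^sub>R z) - t * p z) ` {0..})"
    by (intro bdd_belowI2) auto
qed (use t in auto)

lemma lower_sublinear_greatest:
  "(\<And>t. 0 \<le> t \<Longrightarrow> c \<le> p (x + t *\<^sub>R z) - t * p z) \<Longrightarrow> c \<le> lower_sublinear p z x"
  unfolding lower_sublinear_def by (rule cINF_greatest) auto

lemma sublinear_lower_sublinear:
  assumes p: "sublinear p"
  shows "sublinear (lower_sublinear p z)"
proof (rule sublinearI)
  have padd: "p (x + y) \<le> p x + p y" for x y using p unfolding sublinear_def by blast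
  have pscale: "0 \<le> r \<Longrightarrow> p (r *\<^sub>R x) = r * p x" for r x using p unfolding sublinear_def by blast
  show "lower_sublinear p z (x + y) \<le> lower_sublinear p z x + lower_sublinear p z y" for x y
  proof -
    have "lower_sublinear p z (x + y) - (p (x + s *\<^sub>R z) - s * p z) \<le> p (y + t *\<^sub>R z) - t * p z"
      if "0 \<le> s" "0 \<le> t" for s t
      using lower_sublinear_le[OF p, of "s + t" z "x + y"] padd[of "x + s *\<^sub>R z" "y + t *\<^sub>R z"] that
      by (simp add: algebra_simps)
    then have "lower_sublinear p z (x + y) - (p (x + s *\<^sub>R z) - s * p z) \<le> lower_sublinear p z y"
      if "0 \<le> s" for s
      using that by (intro lower_sublinear_greatest)
    then have "lower_sublinear p z (x + y) - lower_sublinear p z y \<le> lower_sublinear p z x"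
      by (intro lower_sublinear_greatest) (simp add: algebra_simps)
    then show ?thesis by simp
  qed
  show "lower_sublinear p z 0 = 0"
    unfolding lower_sublinear_def by (simp add: pscale)
  show "lower_sublinear p z (r *\<^sub>R x) \<le> r * lower_sublinear p z x" if r: "0 < r" for r x
  proof -
    have "lower_sublinear p z (r *\<^sub>R x) / r \<le> p (x + t *\<^sub>R z) - t * p z" if t: "0 \<le> t" for t
    proof -
      have "lower_sublinear p z (r *\<^sub>R x) \<le> p (r *\<^sub>R x + (r * t) *\<^sub>R z) - r * t * p z"
        using r t by (intro lower_sublinear_le[OF p]) simp
      also have "p (r *\<^sub>R x + (r * t) *\<^sub>R z) = r * p (x + t *\<^sub>R z)"
        using pscale[of r "x + t *\<^sub>R z"] r by (simp add: scaleR_add_right)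
      finally show ?thesis using r by (simp add: field_simps)
    qed
    then have "lower_sublinear p z (r *\<^sub>R x) / r \<le> lower_sublinear p z x"
      by (rule lower_sublinear_greatest)
    then show ?thesis using r by (simp add: field_simps)
  qed
qed

lemma lower_sublinear_le_self: "sublinear p \<Longrightarrow> lower_sublinear p z x \<le> p x"
  using lower_sublinear_le[of p 0 z x] by simp

lemma lower_sublinear_neg: "sublinear p \<Longrightarrow> lower_sublinear p z (- z) \<le> - p z"
  using lower_sublinear_le[of p 1 z "- z"] by (simp add: sublinear_zero)

text \<open>
  Zorn's lemma applies because the infimum of a chain of sublinear functionals below \<open>p\<close> is sublinear, and
  it is finite because each member is at least \<open>- p (- x)\<close> at \<open>x\<close>.
\<close>

lemma minimal_sublinear:
  fixes p :: "'a::real_vector \<Rightarrow> real"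
  assumes p: "sublinear p"
  obtains m where "sublinear m" "m \<le> p" "\<And>q. sublinear q \<Longrightarrow> q \<le> m \<Longrightarrow> q = m"
proof -
  define S where "S = {q :: 'a \<Rightarrow> real. sublinear q \<and> q \<le> p}"
  have "\<exists>m\<in>S. \<forall>a\<in>S. a \<le> m \<longrightarrow> a = m"
  proof (rule predicate_Zorn)
    show "partial_order_on S (relation_of (\<lambda>q r. r \<le> q) S)"
      by (rule partial_order_on_relation_ofI) auto
    fix C assume C: "C \<in> Chains (relation_of (\<lambda>q r. r \<le> q) S)"
    have CS: "C \<subseteq> S" using C by (auto simp: Chains_def relation_of_def)
    have comp: "q \<le> r \<or> r \<le> q" if "q \<in> C" "r \<in> C" for q r
      using C that by (auto simp: Chains_def relation_of_def)
    show "\<exists>u\<in>S. \<forall>a\<in>C. u \<le> a"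
    proof (cases "C = {}")
      case True
      then show ?thesis using p by (auto simp: S_def)
    next
      case False
      define u where "u x = (INF q\<in>C. q x)" for x
      have bdd: "bdd_below ((\<lambda>q. q x) ` C)" for x
      proof (rule bdd_belowI2)
        fix q assume "q \<in> C"
        then have q: "sublinear q" "q (- x) \<le> p (- x)" using CS by (auto simp: S_def le_fun_def)
        show "- p (- x) \<le> q x"
          using sublinear_neg_le[OF q(1), of x] q(2) by simp
      qed
      have low: "u x \<le> q x" if "q \<in> C" for q x
        unfolding u_def by (rule cINF_lower[OF bdd that])
      have great: "c \<le> u x" if "\<And>q. q \<in> C \<Longrightarrow> c \<le> q x" for c x
        unfolding u_def by (rule cINF_greatest[OF False that])
      obtain q0 where "q0 \<in> C" using False by blast
      have "sublinear u"
      proof (rule sublinearI)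
        fix x y
        have key: "u (x + y) \<le> q x + r y" if qr: "q \<in> C" "r \<in> C" for q r
        proof -
          obtain s where s: "s \<in> C" "s \<le> q" "s \<le> r" using comp[OF qr] qr by blast
          have "u (x + y) \<le> s (x + y)" by (rule low[OF s(1)])
          also have "\<dots> \<le> s x + s y" using s(1) CS by (auto simp: S_def sublinear_def)
          also have "\<dots> \<le> q x + r y" using s(2,3) by (auto simp: le_fun_def intro: add_mono)
          finally show ?thesis .
        qed
        have "u (x + y) - q x \<le> u y" if "q \<in> C" for q
          using key[OF that] by (intro great) (simp add: diff_le_eq add.commute)
        then have "u (x + y) - u y \<le> u x"
          by (intro great) (simp add: algebra_simps)
        then show "u (x + y) \<le> u x + u y" by simp
      next
        have "q 0 = 0" if "q \<in> C" for q using that CS by (auto simp: S_def sublinear_zero)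
        then show "u 0 = 0"
          using low great \<open>q0 \<in> C\<close> by (metis antisym order_refl)
      next
        fix r :: real and x assume r: "0 < r"
        have "u (r *\<^sub>R x) / r \<le> u x"
        proof (rule great)
          fix q assume q: "q \<in> C"
          then have "q (r *\<^sub>R x) = r * q x" using CS r by (auto simp: S_def sublinear_def)
          then show "u (r *\<^sub>R x) / r \<le> q x"
            using low[OF q, of "r *\<^sub>R x"] r by (simp add: field_simps)
        qed
        then show "u (r *\<^sub>R x) \<le> r * u x" using r by (simp add: field_simps)
      qed
      moreover have "u \<le> p"
      proof (rule le_funI)
        fix x
        have "q0 x \<le> p x" using CS \<open>q0 \<in> C\<close> by (auto simp: S_def le_fun_def)
        then show "u x \<le> p x" using low[OF \<open>q0 \<in> C\<close>, of x] by simp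
      qed
      ultimately show ?thesis using low by (auto simp: S_def le_fun_def)
    qed
  qed
  then obtain m where m: "m \<in> S" "\<And>a. a \<in> S \<Longrightarrow> a \<le> m \<Longrightarrow> a = m" by blast
  show ?thesis
  proof (rule that)
    show "sublinear m" "m \<le> p" using m(1) by (simp_all add: S_def)
    fix q assume "sublinear q" "q \<le> m"
    then show "q = m" using m(2)[of q] order_trans[OF _ \<open>m \<le> p\<close>] by (simp add: S_def)
  qed
qed

text \<open>
  A minimal sublinear functional \<open>m\<close> is linear: \<open>lower_sublinear m x\<close> lies below \<open>m\<close>, so it equals \<open>m\<close>,
  and this forces \<open>m (- x) = - m x\<close>. Choosing \<open>m\<close> below \<open>lower_sublinear p z\<close> rather than below \<open>p\<close>
  makes it attain the value \<open>p z\<close> at \<open>z\<close>.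
\<close>

theorem hahn_banach_attained:
  fixes p :: "'a::real_vector \<Rightarrow> real"
  assumes p: "sublinear p"
  shows "\<exists>f. linear f \<and> (\<forall>x. f x \<le> p x) \<and> f z = p z"
proof -
  obtain m where m: "sublinear m" "m \<le> lower_sublinear p z" "\<And>q. sublinear q \<Longrightarrow> q \<le> m \<Longrightarrow> q = m"
    using minimal_sublinear[OF sublinear_lower_sublinear[OF p]] by blast
  have madd: "m (x + y) \<le> m x + m y" for x y using m(1) unfolding sublinear_def by blast
  have mscale: "m (r *\<^sub>R x) = r * m x" if "0 \<le> r" for r x
    using m(1) that unfolding sublinear_def by blast
  have mneg: "m (- x) = - m x" for x
  proof -
    have "lower_sublinear m x = m"
      by (rule m(3)) (auto simp: le_fun_def sublinear_lower_sublinear lower_sublinear_le_self m(1))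
    then have "m (- x) \<le> - m x"
      using lower_sublinear_neg[OF m(1), of x] by simp
    then show ?thesis using sublinear_neg_le[OF m(1), of "- x"] by simp
  qed
  have le: "m x \<le> p x" for x
    using le_funD[OF m(2), of x] lower_sublinear_le_self[OF p, of z x] by simp
  show ?thesis
  proof (intro exI[of _ m] conjI allI)
    show "linear m"
    proof (rule linearI)
      show "m (x + y) = m x + m y" for x y
        using madd[of x y] madd[of "x + y" "- y"] by (simp add: mneg)
      show "m (r *\<^sub>R x) = r *\<^sub>R m x" for r x
      proof (cases "0 \<le> r")
        case True
        then show ?thesis using mscale by simp
      next
        case False
        have "m ((- r) *\<^sub>R (- x)) = (- r) * m (- x)"
          by (rule mscale) (use False in simp)
        then show ?thesis by (simp add: mneg)
      qed
    qed
    show "m x \<le> p x" for x by (rule le)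
    have "m (- z) \<le> - p z"
      using le_funD[OF m(2), of "- z"] lower_sublinear_neg[OF p, of z] by simp
    then show "m z = p z" using le[of z] by (simp add: mneg)
  qed
qed

section \<open>States\<close>

lemma state_add: "\<phi> \<in> states \<Longrightarrow> \<phi> (x + y) = \<phi> x + \<phi> y"
  and state_scaleC: "\<phi> \<in> states \<Longrightarrow> \<phi> (c *\<^sub>C x) = c * \<phi> x"
  and state_one: "\<phi> \<in> states \<Longrightarrow> \<phi> 1 = 1"
  and state_nonneg: "\<phi> \<in> states \<Longrightarrow> \<phi> (x\<^sup>\<star> * x) \<in> \<real>\<^sub>\<ge>\<^sub>0"
  by (simp_all add: states_def)

lemma state_scaleR: "\<phi> \<in> states \<Longrightarrow> \<phi> (r *\<^sub>R x) = complex_of_real r * \<phi> x"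
  using state_scaleC[of \<phi> "complex_of_real r" x] by (simp add: scaleC_of_real)

lemma state_minus: "\<phi> \<in> states \<Longrightarrow> \<phi> (- x) = - \<phi> x"
  using state_scaleR[of \<phi> "-1" x] by simp

lemma state_diff: "\<phi> \<in> states \<Longrightarrow> \<phi> (x - y) = \<phi> x - \<phi> y"
  using state_add[of \<phi> x "- y"] by (simp add: state_minus)

text \<open>
  Polarization: the values of \<open>\<phi>\<close> at \<open>(x + y)\<^sup>\<star> * (x + y)\<close> and at
  \<open>(x + \<i> y)\<^sup>\<star> * (x + \<i> y)\<close> are real.
\<close>

lemma state_hermitian:
  assumes \<phi>: "\<phi> \<in> states"
  shows "\<phi> (y\<^sup>\<star> * x) = cnj (\<phi> (x\<^sup>\<star> * y))"
proof -
  have real: "Im (\<phi> (z\<^sup>\<star> * z)) = 0" for z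
    using state_nonneg[OF \<phi>, of z] by (simp add: complex_nonneg_Reals_iff)
  have "(x + y)\<^sup>\<star> * (x + y) = x\<^sup>\<star> * x + y\<^sup>\<star> * y + (x\<^sup>\<star> * y + y\<^sup>\<star> * x)"
    by (simp add: star_add algebra_simps)
  then have 1: "Im (\<phi> (x\<^sup>\<star> * y)) + Im (\<phi> (y\<^sup>\<star> * x)) = 0"
    using real[of "x + y"] real[of x] real[of y] by (simp add: state_add[OF \<phi>])
  have "(x + \<i> *\<^sub>C y)\<^sup>\<star> * (x + \<i> *\<^sub>C y) = x\<^sup>\<star> * x + y\<^sup>\<star> * y + (\<i> *\<^sub>C (x\<^sup>\<star> * y) - \<i> *\<^sub>C (y\<^sup>\<star> * x))"
    by (simp add: star_add star_scaleC algebra_simps mult_scaleC_left mult_scaleC_right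
        scaleC_scaleC scaleC_minus_left scaleC_minus_one scaleC_add_right scaleC_diff_right)
  then have "Re (\<phi> (x\<^sup>\<star> * y)) - Re (\<phi> (y\<^sup>\<star> * x)) = 0"
    using real[of "x + \<i> *\<^sub>C y"] real[of x] real[of y]
    by (simp add: state_add[OF \<phi>] state_diff[OF \<phi>] state_scaleC[OF \<phi>])
  with 1 show ?thesis by (simp add: complex_eq_iff)
qed

lemma state_Cauchy_Schwarz:
  assumes \<phi>: "\<phi> \<in> states"
  shows "(cmod (\<phi> (x\<^sup>\<star> * y)))\<^sup>2 \<le> Re (\<phi> (x\<^sup>\<star> * x)) * Re (\<phi> (y\<^sup>\<star> * y))"
proof -
  define X Y Z where "X = Re (\<phi> (x\<^sup>\<star> * x))" and "Y = Re (\<phi> (y\<^sup>\<star> * y))" and "Z = \<phi> (x\<^sup>\<star> * y)"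
  have nonneg: "0 \<le> Re (\<phi> (z\<^sup>\<star> * z))" for z
    using state_nonneg[OF \<phi>, of z] by (simp add: complex_nonneg_Reals_iff)
  have Y: "0 \<le> Y" using nonneg by (simp add: Y_def)
  have quad: "2 * t * (cmod Z)\<^sup>2 \<le> X + t\<^sup>2 * (cmod Z)\<^sup>2 * Y" for t
  proof -
    define c where "c = - complex_of_real t * cnj Z"
    have "(x + c *\<^sub>C y)\<^sup>\<star> * (x + c *\<^sub>C y) = x\<^sup>\<star> * x + (cnj c * c) *\<^sub>C (y\<^sup>\<star> * y)
        + (c *\<^sub>C (x\<^sup>\<star> * y) + cnj c *\<^sub>C (y\<^sup>\<star> * x))"
      by (simp add: star_add star_scaleC algebra_simps mult_scaleC_left mult_scaleC_right
          scaleC_scaleC scaleC_add_right)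
    then have "\<phi> ((x + c *\<^sub>C y)\<^sup>\<star> * (x + c *\<^sub>C y)) =
        \<phi> (x\<^sup>\<star> * x) + (cnj c * c) * \<phi> (y\<^sup>\<star> * y) + (c * Z + cnj (c * Z))"
      by (simp add: state_add[OF \<phi>] state_scaleC[OF \<phi>] state_hermitian[OF \<phi>, of y x] Z_def)
    moreover have "cnj c * c = complex_of_real (t\<^sup>2 * (cmod Z)\<^sup>2)"
      unfolding cmod_power2 by (simp add: c_def complex_eq_iff power2_eq_square algebra_simps)
    moreover have "c * Z = complex_of_real (- t * (cmod Z)\<^sup>2)"
      unfolding cmod_power2 by (simp add: c_def complex_eq_iff power2_eq_square algebra_simps)
    ultimately have "Re (\<phi> ((x + c *\<^sub>C y)\<^sup>\<star> * (x + c *\<^sub>C y))) = X + t\<^sup>2 * (cmod Z)\<^sup>2 * Y - 2 * t * (cmod Z)\<^sup>2"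
      by (simp add: X_def Y_def)
    with nonneg[of "x + c *\<^sub>C y"] show ?thesis by simp
  qed
  show ?thesis
  proof (cases "Y = 0")
    case True
    have "2 * t * (cmod Z)\<^sup>2 \<le> X" for t using quad[of t] True by simp
    \<comment> \<open>this parameter would turn the bound into \<open>X + 1 \<le> X\<close>\<close>
    from this[of "(X + 1) / (2 * (cmod Z)\<^sup>2)"] have "Z = 0"
      by (cases "Z = 0") (auto simp: field_simps)
    then show ?thesis using True by (simp add: Z_def Y_def)
  next
    case False
    with Y have "Y > 0" by simp
    with quad[of "1 / Y"] have "(cmod Z)\<^sup>2 / Y \<le> X"
      by (simp add: power2_eq_square field_simps)
    with \<open>Y > 0\<close> show ?thesis by (simp add: field_simps X_def Y_def Z_def)
  qed
qed

text \<open>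
  A state need not be continuous by definition; the bound comes from algebra alone, since
  \<open>(norm x)\<^sup>2 *\<^sub>R 1 - x\<^sup>\<star> * x\<close> is a square.
\<close>

lemma state_star_mult_le:
  assumes \<phi>: "\<phi> \<in> states"
  shows "Re (\<phi> (x\<^sup>\<star> * x)) \<le> (norm x)\<^sup>2"
proof -
  define h where "h = x\<^sup>\<star> * x"
  have hs: "h\<^sup>\<star> = h" by (simp add: h_def star_mult star_star)
  obtain v where v: "positive v" "v * v = h"
    using positive_sqrt positive_star_mult h_def by metis
  have vs: "v\<^sup>\<star> = v" using v(1) by (simp add: positive_def)
  obtain w where w: "w\<^sup>\<star> = w" "v * v + w * w = (norm v)\<^sup>2 *\<^sub>R 1"
    using norm_sq_minus_square[OF vs] by blast
  have "(norm v)\<^sup>2 = (norm x)\<^sup>2"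
    using norm_selfadjoint_sq[OF vs] by (simp add: v(2) h_def cstar_identity)
  then have "h + w * w = (norm x)\<^sup>2 *\<^sub>R 1" using w(2) v(2) by simp
  then have "\<phi> h + \<phi> (w * w) = (norm x)\<^sup>2"
    by (metis state_add[OF \<phi>] state_scaleR[OF \<phi>] state_one[OF \<phi>] mult_1_right)
  then have "Re (\<phi> h) + Re (\<phi> (w * w)) = (norm x)\<^sup>2"
    by (metis Re_complex_of_real plus_complex.sel(1))
  moreover have "0 \<le> Re (\<phi> (w * w))"
    using state_nonneg[OF \<phi>, of w] w(1) by (simp add: complex_nonneg_Reals_iff)
  ultimately show ?thesis by (simp add: h_def)
qed

text \<open>
  With \<open>k = 1 - x\<^sup>\<star> * x\<close> one has \<open>\<phi> (k * k) = 1 - 2 + \<phi> ((x\<^sup>\<star> * x)\<^sup>2) \<le> 0\<close>, so Cauchy-Schwarz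
  gives \<open>\<phi> (k * a) = 0\<close>.
\<close>

lemma norming_state_star_mult_mult:
  fixes x a :: "'a::unital_cstar_algebra"
  assumes \<phi>: "\<phi> \<in> norming_states x" and x: "norm x = 1"
  shows "\<phi> (x\<^sup>\<star> * (x * a)) = \<phi> a"
proof -
  have st: "\<phi> \<in> states" and 1: "\<phi> (x\<^sup>\<star> * x) = 1"
    using \<phi> x by (auto simp: norming_states_def)
  define h k where "h = x\<^sup>\<star> * x" and "k = 1 - h"
  have hs: "h\<^sup>\<star> = h" by (simp add: h_def star_mult star_star)
  have ks: "k\<^sup>\<star> = k" by (simp add: k_def star_diff hs)
  have "k\<^sup>\<star> * k = 1 - 2 *\<^sub>R h + h\<^sup>\<star> * h" unfolding ks hs by (simp add: k_def algebra_simps scaleR_2)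
  then have "\<phi> (k\<^sup>\<star> * k) = \<phi> (h\<^sup>\<star> * h) - 1"
    using 1 by (simp add: state_add[OF st] state_diff[OF st] state_scaleR[OF st] state_one[OF st] h_def)
  moreover have "Re (\<phi> (h\<^sup>\<star> * h)) \<le> 1"
    using state_star_mult_le[OF st, of h] by (simp add: h_def cstar_identity x)
  ultimately have "Re (\<phi> (k\<^sup>\<star> * k)) \<le> 0" by simp
  moreover have "0 \<le> Re (\<phi> (a\<^sup>\<star> * a))"
    using state_nonneg[OF st, of a] by (simp add: complex_nonneg_Reals_iff)
  ultimately have "(cmod (\<phi> (k\<^sup>\<star> * a)))\<^sup>2 \<le> 0"
    using state_Cauchy_Schwarz[OF st, of k a] mult_nonpos_nonneg order_trans by blast
  then have "\<phi> (k * a) = 0" by (simp add: ks)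
  then show ?thesis
    by (simp add: k_def h_def algebra_simps state_diff[OF st] mult.assoc)
qed

lemma state_pairing_le:
  fixes x :: "'a::unital_cstar_algebra"
  assumes \<phi>: "\<phi> \<in> states" and x: "norm x \<le> 1"
  shows "Re (\<phi> (x\<^sup>\<star> * y)) \<le> norm y"
proof -
  have "Re (\<phi> (x\<^sup>\<star> * x)) \<le> 1"
    using state_star_mult_le[OF \<phi>, of x] power_le_one[of "norm x" 2] x by simp
  moreover have "0 \<le> Re (\<phi> (y\<^sup>\<star> * y))"
    using state_nonneg[OF \<phi>, of y] by (simp add: complex_nonneg_Reals_iff)
  ultimately have "Re (\<phi> (x\<^sup>\<star> * x)) * Re (\<phi> (y\<^sup>\<star> * y)) \<le> 1 * Re (\<phi> (y\<^sup>\<star> * y))"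
    by (intro mult_right_mono)
  then have "(cmod (\<phi> (x\<^sup>\<star> * y)))\<^sup>2 \<le> (norm y)\<^sup>2"
    using state_Cauchy_Schwarz[OF \<phi>, of x y] state_star_mult_le[OF \<phi>, of y] by linarith
  then have "cmod (\<phi> (x\<^sup>\<star> * y)) \<le> norm y"
    by (rule power2_le_imp_le) simp
  then show ?thesis using complex_Re_le_cmod order_trans by blast
qed

section \<open>Existence of norming states\<close>

text \<open>
  Hahn-Banach gives a real-linear \<open>f\<close> below the norm that attains it at \<open>1 + h\<close> for \<open>h = x\<^sup>\<star> * x\<close>; as
  \<open>norm (1 + h) = 1 + norm h\<close>, it attains the norm at \<open>1\<close> and at \<open>h\<close> separately. Such a functional is
  nonnegative on positive elements. The state is the complex-linear extension of the restriction of \<open>f\<close> to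
  the self-adjoint elements, which has the right values on them without any estimate of its norm.
\<close>

lemma norming_states_nonempty:
  fixes x :: "'a::unital_cstar_algebra"
  shows "norming_states x \<noteq> {}"
proof -
  define h where "h = x\<^sup>\<star> * x"
  have hpos: "positive h" unfolding h_def by (rule positive_star_mult)
  have norm_sub: "sublinear (norm :: 'a \<Rightarrow> real)"
    by (rule sublinearI) (simp_all add: norm_triangle_ineq)
  obtain f where f: "linear f" "\<And>y. f y \<le> norm y" "f (1 + h) = norm (1 + h)"
    using hahn_banach_attained[OF norm_sub, of "1 + h"] by blast
  have fadd: "f (y + z) = f y + f z" and fscale: "f (r *\<^sub>R y) = r * f y"
    and fdiff: "f (y - z) = f y - f z" and fneg: "f (- y) = - f y" for y z r
    using linear_add[OF f(1)] linear_scale[OF f(1)] linear_diff[OF f(1)] linear_neg[OF f(1)] by auto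
  have "f 1 + f h = 1 + norm h"
    using f(3) by (simp add: fadd norm_one_plus_positive[OF hpos])
  moreover have "f 1 \<le> 1" "f h \<le> norm h" using f(2)[of 1] f(2)[of h] by simp_all
  ultimately have f1: "f 1 = 1" and fh: "f h = norm h" by linarith+
  have fpos: "0 \<le> f a" if "positive a" for a
  proof -
    obtain t where t: "norm (t *\<^sub>R 1 - a) \<le> t" using \<open>positive a\<close> unfolding positive_def by blast
    have "t - f a = f (t *\<^sub>R 1 - a)" by (simp add: fdiff fscale f1)
    also have "\<dots> \<le> t" using f(2) t order_trans by blast
    finally show ?thesis by simp
  qed
  define re where "re y = (1/2) *\<^sub>R (y + y\<^sup>\<star>)" for y :: 'a
  \<comment> \<open>the imaginary part of \<open>y\<close> is \<open>- re (\<i> y)\<close>\<close>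
  define \<phi> where "\<phi> y = Complex (f (re y)) (- f (re (\<i> *\<^sub>C y)))" for y
  have re_add: "re (y + z) = re y + re z" for y z
    by (simp add: re_def star_add algebra_simps)
  have re_scale: "re (r *\<^sub>R y) = r *\<^sub>R re y" for r y
    by (simp add: re_def star_scaleR algebra_simps)
  have \<phi>_add: "\<phi> (y + z) = \<phi> y + \<phi> z" for y z
    by (simp add: \<phi>_def re_add scaleC_add_right fadd complex_eq_iff)
  have iscale: "\<i> *\<^sub>C r *\<^sub>R y = r *\<^sub>R \<i> *\<^sub>C y" for r and y :: 'a
    by (simp add: scaleC_scaleC mult.commute flip: scaleC_of_real)
  have \<phi>_scaleR: "\<phi> (r *\<^sub>R y) = complex_of_real r * \<phi> y" for r y
    by (simp add: \<phi>_def re_scale iscale fscale complex_eq_iff)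
  have re_neg: "re (- y) = - re y" for y
    using re_scale[of "-1" y] by simp
  have \<phi>_i: "\<phi> (\<i> *\<^sub>C y) = \<i> * \<phi> y" for y
    by (simp add: \<phi>_def scaleC_scaleC scaleC_minus_one re_neg fneg complex_eq_iff)
  have \<phi>_scale: "\<phi> (c *\<^sub>C y) = c * \<phi> y" for c y
  proof -
    have "c *\<^sub>C y = Re c *\<^sub>R y + Im c *\<^sub>R \<i> *\<^sub>C y"
      by (subst complex_eq[of c])
        (simp add: scaleC_add_left scaleC_scaleC mult.commute flip: scaleC_of_real)
    then have "\<phi> (c *\<^sub>C y) = (complex_of_real (Re c) + \<i> * complex_of_real (Im c)) * \<phi> y"
      by (simp add: \<phi>_add \<phi>_scaleR \<phi>_i algebra_simps)
    then show ?thesis by (simp flip: complex_eq)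
  qed
  have \<phi>_sa: "\<phi> y = complex_of_real (f y)" if "y\<^sup>\<star> = y" for y
  proof -
    have "re y = y" by (simp add: re_def that flip: scaleR_2)
    moreover have "re (\<i> *\<^sub>C y) = 0" by (simp add: re_def star_scaleC that scaleC_minus_left)
    ultimately show ?thesis using fscale[of 0 0] by (simp add: \<phi>_def complex_eq_iff)
  qed
  have sa: "(y\<^sup>\<star> * y)\<^sup>\<star> = y\<^sup>\<star> * y" for y :: 'a by (simp add: star_mult star_star)
  have "\<phi> \<in> states"
    unfolding states_def
    using fpos[OF positive_star_mult]
    by (auto simp: \<phi>_add \<phi>_scale \<phi>_sa sa f1 complex_nonneg_Reals_iff)
  moreover have "\<phi> (x\<^sup>\<star> * x) = complex_of_real ((norm x)\<^sup>2)"
    using fh by (simp add: \<phi>_sa sa h_def cstar_identity)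
  ultimately show ?thesis unfolding norming_states_def by blast
qed

section \<open>Smooth points of the norm\<close>

text \<open>
  Gateaux differentiability of the norm at \<open>x\<close> in the directions of \<open>A\<close>. By convexity, the quotient of the
  symmetric second difference by the step is monotone in the step, so one step with a small quotient shows
  that the one-sided derivatives agree up to \<open>\<epsilon>\<close>. In this form the condition for given \<open>y\<close> and
  \<open>\<epsilon>\<close> is open in \<open>x\<close>.
\<close>

definition smooth_along :: "'a::real_normed_vector set \<Rightarrow> 'a \<Rightarrow> bool" where
  "smooth_along A x \<longleftrightarrow>
     (\<forall>y\<in>A. \<forall>\<epsilon>>0. \<exists>t>0. norm (x + t *\<^sub>R y) + norm (x - t *\<^sub>R y) < 2 * norm x + t * \<epsilon>)"

text \<open>
  Over an arithmetic progression with step \<open>t\<close> the second differences telescope to a difference of two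
  first differences, at most \<open>2 * L * t\<close>. If all \<open>N\<close> of them were at least \<open>t * \<epsilon>\<close>, then
  \<open>N * \<epsilon> \<le> 2 * L\<close>, which fails for large \<open>N\<close>.
\<close>

lemma small_second_difference:
  fixes g :: "real \<Rightarrow> real"
  assumes lip: "\<And>s t. \<bar>g s - g t\<bar> \<le> L * \<bar>s - t\<bar>" and \<epsilon>: "0 < \<epsilon>" and \<delta>: "0 < \<delta>"
  shows "\<exists>s t. 0 \<le> s \<and> s \<le> \<delta> \<and> 0 < t \<and> g (s + t) + g (s - t) < 2 * g s + t * \<epsilon>"
proof (rule ccontr)
  assume contr: "\<not> ?thesis"
  then have no: "2 * g s + t * \<epsilon> \<le> g (s + t) + g (s - t)" if "0 \<le> s" "s \<le> \<delta>" "0 < t" for s t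
    using contr that not_le by blast
  obtain N :: nat where N: "2 * L / \<epsilon> < real N" using reals_Archimedean2 by blast
  define t where "t = \<delta> / (real N + 1)"
  have t: "0 < t" using \<delta> by (simp add: t_def)
  have "g (real k * t + t) - g (real k * t) \<ge> g t - g 0 + real k * (t * \<epsilon>)" if "k \<le> N" for k
    using that
  proof (induction k)
    case (Suc k)
    have "real (Suc k) * t \<le> (real N + 1) * t"
      using Suc.prems t by (intro mult_right_mono) auto
    then have "real (Suc k) * t \<le> \<delta>" by (simp add: t_def)
    then have "2 * g (real (Suc k) * t) + t * \<epsilon> \<le> g (real (Suc k) * t + t) + g (real (Suc k) * t - t)"
      using t by (intro no) auto
    moreover have "real (Suc k) * t - t = real k * t" "real (Suc k) * t = real k * t + t"
      by (simp_all add: algebra_simps)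
    ultimately show ?case
      using Suc by (simp add: algebra_simps)
  qed simp
  from this[of N] have "real N * (t * \<epsilon>) \<le> g (real N * t + t) - g (real N * t) - (g t - g 0)"
    by simp
  also have "\<dots> \<le> L * t + L * t"
    using lip[of "real N * t + t" "real N * t"] lip[of t 0] t by simp
  finally have "(real N * \<epsilon>) * t \<le> (2 * L) * t" by (simp add: algebra_simps)
  then have "real N * \<epsilon> \<le> 2 * L" using t by simp
  with N \<epsilon> show False by (simp add: field_simps)
qed

text \<open>
  Separability passes to subsets of a metric space: from each ball around a point of the given dense
  set with radius \<open>1 / Suc n\<close> pick a point of \<open>A\<close>, if there is one.
\<close>

lemma countable_dense_subset:
  fixes A :: "'a::metric_space set"
  assumes "separable_space (euclidean :: 'a topology)"
  obtains D where "countable D" "D \<subseteq> A" "\<And>a e. a \<in> A \<Longrightarrow> 0 < e \<Longrightarrow> \<exists>d\<in>D. dist d a < e"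
proof -
  obtain C :: "'a set" where C: "countable C" "closure C = UNIV"
    using assms unfolding separable_space_def by auto
  define P where "P = {(c, n). c \<in> C \<and> (\<exists>a\<in>A. dist c a < 1 / real (Suc n))}"
  define pick where "pick = (\<lambda>(c, n). SOME a. a \<in> A \<and> dist c a < 1 / real (Suc n))"
  have pick: "pick (c, n) \<in> A" "dist c (pick (c, n)) < 1 / real (Suc n)" if "(c, n) \<in> P" for c n
    using that someI_ex[of "\<lambda>a. a \<in> A \<and> dist c a < 1 / real (Suc n)"]
    by (auto simp: P_def pick_def)
  show ?thesis
  proof (rule that[of "pick ` P"])
    have "P \<subseteq> C \<times> (UNIV :: nat set)" by (auto simp: P_def)
    then show "countable (pick ` P)"
      using C(1) by (meson countable_SIGMA countableI_type countable_image countable_subset)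
    show "pick ` P \<subseteq> A" using pick by auto
    show "\<exists>d\<in>pick ` P. dist d a < e" if a: "a \<in> A" and e: "0 < e" for a e
    proof -
      obtain n where n: "1 / real (Suc n) < e / 2"
        using nat_approx_posE[of "e / 2"] e by auto
      have "a \<in> closure C" using C(2) by simp
      then obtain c where c: "c \<in> C" "dist c a < 1 / real (Suc n)"
        unfolding closure_approachable by (meson of_nat_0_less_iff zero_less_Suc zero_less_divide_1_iff)
      then have cn: "(c, n) \<in> P" using a by (auto simp: P_def)
      have "dist (pick (c, n)) a \<le> dist c (pick (c, n)) + dist c a"
        by (metis dist_triangle2 dist_commute)
      also have "\<dots> < e" using pick(2)[OF cn] c(2) n by simp
      finally show ?thesis using cn by blast
    qed
  qed
qed

text \<open>
  Moving from \<open>x\<close> a short way along \<open>y\<close> leads to a point \<open>w\<close> with a small second difference. The condition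
  is homogeneous when the step is scaled with the point, so it survives the normalization of \<open>w\<close>.
\<close>

lemma dense_directional_smoothness:
  fixes A :: "'a::real_normed_vector set"
  assumes A: "subspace A" and x: "x \<in> A" "norm x = 1" and y: "y \<in> A" and \<epsilon>: "0 < \<epsilon>" and e: "0 < e"
  shows "\<exists>z\<in>A. norm z = 1 \<and> dist z x < e \<and>
    (\<exists>t>0. norm (z + t *\<^sub>R y) + norm (z - t *\<^sub>R y) < 2 + t * \<epsilon>)"
proof -
  \<comment> \<open>keeps \<open>w\<close> within \<open>e / 3\<close> of \<open>x\<close> and away from 0, so that normalizing moves it by at most \<open>e / 3\<close> more\<close>
  define \<delta> where "\<delta> = min (1/2) (e / 3) / (norm y + 1)"
  have ny: "0 < norm y + 1" by (simp add: add_nonneg_pos)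
  have \<delta>: "0 < \<delta>" using ny e by (simp add: \<delta>_def)
  define g where "g s = norm (x + s *\<^sub>R y)" for s
  have "\<bar>g s - g t\<bar> \<le> norm y * \<bar>s - t\<bar>" for s t
  proof -
    have "\<bar>g s - g t\<bar> \<le> norm ((x + s *\<^sub>R y) - (x + t *\<^sub>R y))"
      unfolding g_def by (rule norm_triangle_ineq3)
    also have "(x + s *\<^sub>R y) - (x + t *\<^sub>R y) = (s - t) *\<^sub>R y" by (simp add: algebra_simps)
    finally show ?thesis by (simp add: mult.commute)
  qed
  from small_second_difference[of g, OF this \<epsilon> \<delta>]
  obtain s t where s: "0 \<le> s" "s \<le> \<delta>" and t: "0 < t"
    and st: "g (s + t) + g (s - t) < 2 * g s + t * \<epsilon>"
    by blast
  define w where "w = x + s *\<^sub>R y"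
  define r where "r = norm w"
  define z where "z = (1 / r) *\<^sub>R w"
  have "norm (w - x) \<le> min (1/2) (e / 3)"
  proof -
    have "norm (w - x) = s * norm y" using s by (simp add: w_def)
    also have "\<dots> \<le> \<delta> * (norm y + 1)" using s by (intro mult_mono) auto
    also have "\<dots> = min (1/2) (e / 3)" using ny by (simp add: \<delta>_def)
    finally show ?thesis .
  qed
  then have wx: "norm (w - x) \<le> 1/2" "norm (w - x) \<le> e / 3" by auto
  have r1: "\<bar>r - 1\<bar> \<le> norm (w - x)"
    unfolding r_def x(2)[symmetric] by (rule norm_triangle_ineq3)
  then have r: "0 < r" using wx by linarith
  have "z \<in> A" unfolding z_def w_def using A x y by (intro subspace_scale subspace_add)
  moreover have "norm z = 1" using r by (simp add: z_def r_def)
  moreover have "dist z x < e"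
  proof -
    have "norm (z - w) = \<bar>r - 1\<bar>"
    proof -
      have "z - w = (1 / r - 1) *\<^sub>R w" by (simp add: z_def algebra_simps)
      then have "norm (z - w) = \<bar>1 / r - 1\<bar> * r" by (simp add: r_def)
      also have "\<dots> = \<bar>(1 / r - 1) * r\<bar>" using r by (simp add: abs_mult)
      also have "(1 / r - 1) * r = 1 - r" using r by (simp add: field_simps)
      finally show ?thesis by simp
    qed
    then have "norm (z - x) \<le> \<bar>r - 1\<bar> + norm (w - x)"
      using norm_triangle_ineq[of "z - w" "w - x"] by simp
    then show ?thesis using r1 wx e by (simp add: dist_norm)
  qed
  moreover have "norm (z + (t / r) *\<^sub>R y) + norm (z - (t / r) *\<^sub>R y) < 2 + (t / r) * \<epsilon>"
  proof -
    have "z + (t / r) *\<^sub>R y = (1 / r) *\<^sub>R (x + (s + t) *\<^sub>R y)"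
      and "z - (t / r) *\<^sub>R y = (1 / r) *\<^sub>R (x + (s - t) *\<^sub>R y)"
      by (simp_all add: z_def w_def algebra_simps)
    then have "norm (z + (t / r) *\<^sub>R y) + norm (z - (t / r) *\<^sub>R y) = (g (s + t) + g (s - t)) / r"
      using r by (simp add: g_def add_divide_distrib)
    also have "\<dots> < (2 * r + t * \<epsilon>) / r"
      using st r by (intro divide_strict_right_mono) (simp_all add: g_def r_def w_def)
    also have "\<dots> = 2 + (t / r) * \<epsilon>" using r by (simp add: field_simps)
    finally show ?thesis .
  qed
  ultimately show ?thesis using t r by (intro bexI[of _ z]) (auto intro!: exI[of _ "t / r"])
qed

text \<open>
  For each \<open>y\<close> and \<open>n\<close> the set \<open>U (y, n)\<close> of points satisfying the condition for \<open>y\<close> and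
  \<open>\<epsilon> = 1 / Suc n\<close> is open and dense in the sphere. Countably many directions suffice, because changing
  \<open>y\<close> by \<open>\<eta>\<close> changes the second difference by at most \<open>2 * t * \<eta>\<close>, uniformly in the step \<open>t\<close>.
\<close>

theorem mazur_smooth_points:
  fixes A :: "'a::banach set"
  defines "S \<equiv> {x \<in> A. norm x = 1}"
  assumes A: "subspace A" "closed A" and sep: "separable_space (euclidean :: 'a topology)"
  shows "gdelta_in (top_of_set S) {x \<in> S. smooth_along A x}"
    and "(top_of_set S) closure_of {x \<in> S. smooth_along A x} = S"
proof -
  obtain D where D: "countable D" "D \<subseteq> A" "\<And>a e. a \<in> A \<Longrightarrow> 0 < e \<Longrightarrow> \<exists>d\<in>D. dist d a < e"
    using countable_dense_subset[OF sep] by blast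
  define U where "U = (\<lambda>(y, n::nat). {x \<in> S. \<exists>t>0. norm (x + t *\<^sub>R y) + norm (x - t *\<^sub>R y) < 2 + t * (1 / real (Suc n))})"
  define \<U> where "\<U> = U ` (D \<times> UNIV)"
  have "0 \<in> A" using A(1) by (rule subspace_0)
  then have "D \<noteq> {}" using D(3)[of 0 1] by auto
  then have ne: "\<U> \<noteq> {}" by (simp add: \<U>_def)
  have cnt: "countable \<U>" unfolding \<U>_def using D(1) by (intro countable_image countable_SIGMA) auto
  have opn: "openin (top_of_set S) (U (y, n))" for y n
  proof -
    define V where "V = (\<Union>t\<in>{0<..}. {x. norm (x + t *\<^sub>R y) + norm (x - t *\<^sub>R y) < 2 + t * (1 / real (Suc n))})"
    have "open V"
      unfolding V_def by (intro open_UN ballI open_Collect_less continuous_intros)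
    moreover have "U (y, n) = S \<inter> V" by (auto simp: U_def V_def)
    ultimately show ?thesis by (simp only: openin_open_Int)
  qed
  have dense: "(top_of_set S) closure_of (U (y, n)) = S" if "y \<in> D" for y n
  proof -
    have "x \<in> closure (U (y, n))" if "x \<in> S" for x
      unfolding closure_approachable
    proof (intro allI impI)
      fix e :: real assume "0 < e"
      have "y \<in> A" using \<open>y \<in> D\<close> D(2) by blast
      from dense_directional_smoothness[OF A(1) _ _ this _ \<open>0 < e\<close>, of x "1 / real (Suc n)"]
      obtain z where "z \<in> A" "norm z = 1" "dist z x < e"
        "\<exists>t>0. norm (z + t *\<^sub>R y) + norm (z - t *\<^sub>R y) < 2 + t * (1 / real (Suc n))"
        using \<open>x \<in> S\<close> by (auto simp: S_def)
      then show "\<exists>z\<in>U (y, n). dist z x < e"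
        by (intro bexI[of _ z]) (simp_all add: U_def S_def)
    qed
    moreover have "U (y, n) \<subseteq> S" by (auto simp: U_def)
    ultimately show ?thesis
      by (auto simp: closure_of_subtopology Int_absorb1)
  qed
  have "\<Inter>\<U> = {x \<in> S. smooth_along A x}"
  proof (intro equalityI subsetI)
    fix x assume x: "x \<in> \<Inter>\<U>"
    then have "x \<in> S" using \<open>D \<noteq> {}\<close> by (auto simp: \<U>_def U_def)
    have "\<exists>t>0. norm (x + t *\<^sub>R y) + norm (x - t *\<^sub>R y) < 2 * norm x + t * \<epsilon>" if y: "y \<in> A" and \<epsilon>: "0 < \<epsilon>" for y \<epsilon>
    proof -
      obtain n where n: "1 / real (Suc n) < \<epsilon> / 3" using nat_approx_posE[of "\<epsilon> / 3"] \<epsilon> by auto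
      obtain d where d: "d \<in> D" "dist d y < \<epsilon> / 3" using D(3)[OF y, of "\<epsilon> / 3"] \<epsilon> by auto
      have "x \<in> U (d, n)" using x d(1) by (auto simp: \<U>_def)
      then obtain t where t: "0 < t"
        and lt: "norm (x + t *\<^sub>R d) + norm (x - t *\<^sub>R d) < 2 + t * (1 / real (Suc n))"
        by (auto simp: U_def)
      have td: "norm (t *\<^sub>R (d - y)) = t * norm (d - y)" using t by simp
      have "x + t *\<^sub>R y = (x + t *\<^sub>R d) - t *\<^sub>R (d - y)" by (simp add: algebra_simps)
      then have "norm (x + t *\<^sub>R y) \<le> norm (x + t *\<^sub>R d) + t * norm (d - y)"
        using norm_triangle_ineq4[of "x + t *\<^sub>R d" "t *\<^sub>R (d - y)"] unfolding td by (simp only:)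
      moreover have "x - t *\<^sub>R y = (x - t *\<^sub>R d) + t *\<^sub>R (d - y)" by (simp add: algebra_simps)
      then have "norm (x - t *\<^sub>R y) \<le> norm (x - t *\<^sub>R d) + t * norm (d - y)"
        using norm_triangle_ineq[of "x - t *\<^sub>R d" "t *\<^sub>R (d - y)"] unfolding td by (simp only:)
      moreover have "t * norm (d - y) < t * (\<epsilon> / 3)" using d(2) t by (simp add: dist_norm)
      moreover have "t * (1 / real (Suc n)) < t * (\<epsilon> / 3)" using n t by (rule mult_strict_left_mono)
      moreover have "t * (\<epsilon> / 3) + t * (\<epsilon> / 3) + t * (\<epsilon> / 3) = t * \<epsilon>" by simp
      moreover have "norm x = 1" using \<open>x \<in> S\<close> by (simp add: S_def)
      ultimately have "norm (x + t *\<^sub>R y) + norm (x - t *\<^sub>R y) < 2 * norm x + t * \<epsilon>"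
        using lt by linarith
      with t show ?thesis by blast
    qed
    then show "x \<in> {x \<in> S. smooth_along A x}" using \<open>x \<in> S\<close> by (simp add: smooth_along_def)
  next
    fix x assume x: "x \<in> {x \<in> S. smooth_along A x}"
    then have nx: "norm x = 1" by (simp add: S_def)
    have "x \<in> U (y, n)" if "y \<in> D" for y n
    proof -
      have "y \<in> A" "0 < 1 / real (Suc n)" using that D(2) by auto
      then have "\<exists>t>0. norm (x + t *\<^sub>R y) + norm (x - t *\<^sub>R y) < 2 * norm x + t * (1 / real (Suc n))"
        using x unfolding smooth_along_def by blast
      then show ?thesis using x nx by (simp add: U_def)
    qed
    then show "x \<in> \<Inter>\<U>" by (auto simp: \<U>_def)
  qed
  moreover have "gdelta_in (top_of_set S) (\<Inter>\<U>)"
    using cnt ne opn by (intro gdelta_in_Inter open_imp_gdelta_in) (auto simp: \<U>_def)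
  moreover have "(top_of_set S) closure_of (\<Inter>\<U>) = topspace (top_of_set S)"
  proof (rule Baire_category)
    have "closed {x :: 'a. norm x = 1}"
      by (intro closed_Collect_eq continuous_intros)
    moreover have "S = A \<inter> {x. norm x = 1}" by (auto simp: S_def)
    ultimately have "closed S" using A(2) by (simp only: closed_Int)
    then show "completely_metrizable_space (top_of_set S) \<or>
        locally_compact_space (top_of_set S) \<and> regular_space (top_of_set S)"
      by (intro disjI1 completely_metrizable_space_closedin completely_metrizable_space_euclidean) simp
    show "openin (top_of_set S) T \<and> (top_of_set S) closure_of T = topspace (top_of_set S)" if "T \<in> \<U>" for T
      using that opn dense by (auto simp: \<U>_def)
  qed (rule cnt)
  ultimately show "gdelta_in (top_of_set S) {x \<in> S. smooth_along A x}"
    and "(top_of_set S) closure_of {x \<in> S. smooth_along A x} = S"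
    by simp_all
qed

section \<open>Restrictions of norming states\<close>

text \<open>
  Pairing \<open>\<phi>\<close> with \<open>x + t *\<^sub>R y\<close> and \<open>\<psi>\<close> with \<open>x - t *\<^sub>R y\<close> bounds \<open>t\<close> times the difference of the support
  functionals at \<open>y\<close> by the second difference of the norm. Smoothness makes their real parts agree on \<open>A\<close>;
  inserting \<open>\<i> y\<close> gives the imaginary parts.
\<close>

lemma smooth_norming_states_agree:
  fixes A :: "'a::unital_cstar_algebra set"
  assumes A: "unital_subalgebra A" and x: "x \<in> A" "norm x = 1" and smooth: "smooth_along A x"
    and \<phi>: "\<phi> \<in> norming_states x" and \<psi>: "\<psi> \<in> norming_states x" and a: "a \<in> A"
  shows "\<phi> a = \<psi> a"
proof -
  have Re_le: "Re (\<phi> (x\<^sup>\<star> * y)) \<le> Re (\<psi> (x\<^sup>\<star> * y))"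
    if y: "y \<in> A" and \<phi>: "\<phi> \<in> norming_states x" and \<psi>: "\<psi> \<in> norming_states x" for y and \<phi> \<psi> :: "'a \<Rightarrow> complex"
  proof (rule field_le_epsilon)
    fix \<epsilon> :: real assume \<epsilon>: "0 < \<epsilon>"
    then obtain t where t: "0 < t" and lt: "norm (x + t *\<^sub>R y) + norm (x - t *\<^sub>R y) < 2 * norm x + t * \<epsilon>"
      using smooth y unfolding smooth_along_def by blast
    have st: "\<phi> \<in> states" "\<psi> \<in> states" and 1: "\<phi> (x\<^sup>\<star> * x) = 1" "\<psi> (x\<^sup>\<star> * x) = 1"
      using \<phi> \<psi> x(2) by (auto simp: norming_states_def)
    have "Re (\<phi> (x\<^sup>\<star> * (x + t *\<^sub>R y))) + Re (\<psi> (x\<^sup>\<star> * (x - t *\<^sub>R y))) \<le> norm (x + t *\<^sub>R y) + norm (x - t *\<^sub>R y)"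
      using x(2) by (intro add_mono state_pairing_le st) auto
    also have "\<dots> < 2 + t * \<epsilon>" using lt x(2) by simp
    finally have "t * Re (\<phi> (x\<^sup>\<star> * y)) < t * (Re (\<psi> (x\<^sup>\<star> * y)) + \<epsilon>)"
      by (simp add: distrib_left right_diff_distrib state_add[OF st(1)] state_diff[OF st(2)]
          state_scaleR[OF st(1)] state_scaleR[OF st(2)] 1)
    then show "Re (\<phi> (x\<^sup>\<star> * y)) \<le> Re (\<psi> (x\<^sup>\<star> * y)) + \<epsilon>"
      using t by simp
  qed
  have Re_eq: "Re (\<phi> (x\<^sup>\<star> * y)) = Re (\<psi> (x\<^sup>\<star> * y))" if "y \<in> A" for y
    using Re_le[OF that \<phi> \<psi>] Re_le[OF that \<psi> \<phi>] by simp
  have st: "\<phi> \<in> states" "\<psi> \<in> states" using \<phi> \<psi> by (auto simp: norming_states_def)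
  have xa: "x * a \<in> A" and ixa: "\<i> *\<^sub>C (x * a) \<in> A"
    using A x(1) a by (auto simp: unital_subalgebra_def)
  have "Im (\<phi> (x\<^sup>\<star> * (x * a))) = Im (\<psi> (x\<^sup>\<star> * (x * a)))"
    using Re_eq[OF ixa] by (simp add: mult_scaleC_right state_scaleC[OF st(1)] state_scaleC[OF st(2)])
  with Re_eq[OF xa] have "\<phi> (x\<^sup>\<star> * (x * a)) = \<psi> (x\<^sup>\<star> * (x * a))"
    by (simp add: complex_eq_iff)
  then show ?thesis
    by (simp add: norming_state_star_mult_mult[OF \<phi> x(2)] norming_state_star_mult_mult[OF \<psi> x(2)])
qed

theorem theorem5p6:
  fixes A A\<^sub>0 :: "'b::unital_cstar_algebra set"
  assumes "separable_space (euclidean :: 'b topology)"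
    and "unital_subalgebra A"
    and "closed A"
    and "A\<^sub>0 = {x \<in> A. norm x = 1 \<and> is_singleton (restricted_norming_states A x)}"
  shows "\<exists>G. G \<subseteq> A\<^sub>0 \<and>
             gdelta_in (top_of_set (unit_sphere A)) G \<and>
             (top_of_set (unit_sphere A)) closure_of G = unit_sphere A"
proof -
  have "r *\<^sub>R x \<in> A" if "x \<in> A" for r x
    using that assms(2) unfolding unital_subalgebra_def by (metis scaleC_of_real)
  moreover from this[of 1 0] have "0 \<in> A"
    using assms(2) unfolding unital_subalgebra_def by simp
  ultimately have "subspace A"
    using assms(2) unfolding unital_subalgebra_def subspace_def by blast
  define G where "G = {x \<in> unit_sphere A. smooth_along A x}"
  have "x \<in> A\<^sub>0" if "x \<in> G" for x
  proof -
    have x: "x \<in> A" "norm x = 1" "smooth_along A x"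
      using that by (auto simp: G_def unit_sphere_def)
    obtain \<phi> where \<phi>: "\<phi> \<in> norming_states x" using norming_states_nonempty by blast
    have "restrict \<psi> A = restrict \<phi> A" if "\<psi> \<in> norming_states x" for \<psi>
      using smooth_norming_states_agree[OF assms(2) x that \<phi>] by (auto simp: restrict_def)
    then have "restricted_norming_states A x = {restrict \<phi> A}"
      unfolding restricted_norming_states_def using \<phi> by blast
    then show ?thesis using x assms(4) by (simp add: is_singleton_def)
  qed
  then have "G \<subseteq> A\<^sub>0" by blast
  moreover note mazur_smooth_points[OF \<open>subspace A\<close> assms(3,1), folded unit_sphere_def G_def]
  ultimately show ?thesis by blast
qed

end
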